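(* Let $\Gamma$ be a graph and let $A(\Gamma)$ be the associated right-angled Artin group. Suppose $A(\Gamma)$ has a non-trivial minimal action on a tree $T$ which is not a line. Then $\Gamma$ has an induced subgraph $\Lambda$ such that $\Gamma\setminus\Lambda$ is disconnected and $A(\Lambda)$ stabilizes an edge in $T$, i.e. there is an edge $e$ of $T$ with $A(\Lambda)\leq \mathrm{Stab}(e)$.
   Context: For a graph $\Gamma$ with vertex set $V(\Gamma)$ and edge set $E(\Gamma)$, the right-angled Artin group $A(\Gamma)$ is the group given by the presentation $\langle V(\Gamma)\mid [u,v]=1 \text{ whenever } (u,v)\in E(\Gamma)\rangle$. For an induced subgraph $\Lambda$ of $\Gamma$, $A(\Lambda)$ is identified with the subgroup of $A(\Gamma)$ generated by the vertices of $\Lambda$. The subgraph $\Lambda$ is allowed to be empty, in which case $A(\Lambda)$ is the trivial subgroup. $\Gamma\setminus\Lambda$ denotes the subgraph of $\Gamma$ induced on the vertices not in $\Lambda$; disconnected means having at least two connected components. All trees are simplicial trees and groups act on them by simplicial automorphisms. An action of a group $G$ on a tree $T$ is minimal if $T$ has no proper $G$-invariant subtrees, and non-trivial if there is no point of $T$ which is fixed by all elements of $G$. A line is a tree that is a bi-infinite path (homeomorphic to $\mathbb{R}$). $\mathrm{Stab}(e)$ is the stabilizer of the edge $e$ in $A(\Gamma)$. *)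

theory Defs
  imports Complex_Main "HOL-Algebra.Group_Action" "HOL-Algebra.Generated_Groups"
begin

section \<open>Graphs\<close>

text \<open>Graphs are simple and undirected, possibly infinite: an edge is a two-element set of vertices.\<close>

record 'a ugraph =
  verts :: "'a set"
  edges :: "'a set set"

definition simple_graph :: "'a ugraph \<Rightarrow> bool" where
  "simple_graph G \<longleftrightarrow>
     (\<forall>e \<in> edges G. \<exists>u \<in> verts G. \<exists>v \<in> verts G. u \<noteq> v \<and> e = {u, v})"

definition is_subgraph :: "'a ugraph \<Rightarrow> 'a ugraph \<Rightarrow> bool" where
  "is_subgraph H G \<longleftrightarrow> simple_graph H \<and> verts H \<subseteq> verts G \<and> edges H \<subseteq> edges G"

definition induced_on :: "'a ugraph \<Rightarrow> 'a set \<Rightarrow> 'a ugraph" where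
  "induced_on G S = \<lparr>verts = S, edges = {e \<in> edges G. e \<subseteq> S}\<rparr>"

definition induced_subgraph :: "'a ugraph \<Rightarrow> 'a ugraph \<Rightarrow> bool" where
  "induced_subgraph H G \<longleftrightarrow> verts H \<subseteq> verts G \<and> H = induced_on G (verts H)"

definition graph_diff :: "'a ugraph \<Rightarrow> 'a ugraph \<Rightarrow> 'a ugraph" where
  "graph_diff G H = induced_on G (verts G - verts H)"

definition walk_rel :: "'a ugraph \<Rightarrow> ('a \<times> 'a) set" where
  "walk_rel G = {(u, v). u \<in> verts G \<and> v \<in> verts G \<and> (u, v) \<in> {(x, y). {x, y} \<in> edges G}\<^sup>*}"

definition components :: "'a ugraph \<Rightarrow> 'a set set" where
  "components G = verts G // walk_rel G"

text \<open>The graph without vertices has no component, so it is neither connected nor disconnected.\<close>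

definition connected_graph :: "'a ugraph \<Rightarrow> bool" where
  "connected_graph G \<longleftrightarrow> (\<exists>C. components G = {C})"

definition disconnected_graph :: "'a ugraph \<Rightarrow> bool" where
  "disconnected_graph G \<longleftrightarrow> (\<exists>C \<in> components G. \<exists>D \<in> components G. C \<noteq> D)"

definition is_cycle :: "'a ugraph \<Rightarrow> 'a list \<Rightarrow> bool" where
  "is_cycle G c \<longleftrightarrow> 3 \<le> length c \<and> distinct c \<and>
     (\<forall>i. Suc i < length c \<longrightarrow> {c ! i, c ! Suc i} \<in> edges G) \<and> {last c, hd c} \<in> edges G"


section \<open>Trees\<close>

definition is_tree :: "'a ugraph \<Rightarrow> bool" where
  "is_tree T \<longleftrightarrow> simple_graph T \<and> connected_graph T \<and> (\<nexists>c. is_cycle T c)"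

definition is_line :: "'a ugraph \<Rightarrow> bool" where
  "is_line T \<longleftrightarrow>
     (\<exists>f :: int \<Rightarrow> 'a. bij_betw f UNIV (verts T) \<and> edges T = {{f i, f (i + 1)} | i. True})"

text \<open>
  A point of the geometric realization, given by its barycentric coordinates with respect to the
  vertices. The support of such a point is a single vertex or a single edge.
\<close>

definition realization :: "'a ugraph \<Rightarrow> ('a \<Rightarrow> real) set" where
  "realization T = {p. (\<forall>x. 0 \<le> p x) \<and>
     ((\<exists>v \<in> verts T. {x. p x \<noteq> 0} = {v}) \<or> {x. p x \<noteq> 0} \<in> edges T) \<and>
     (\<Sum>x | p x \<noteq> 0. p x) = 1}"


section \<open>Actions on trees\<close>

definition tree_action :: "('g, 'm) monoid_scheme \<Rightarrow> 't ugraph \<Rightarrow> ('g \<Rightarrow> 't \<Rightarrow> 't) \<Rightarrow> bool" where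
  "tree_action G T \<phi> \<longleftrightarrow> is_tree T \<and> group_action G (verts T) \<phi> \<and>
     (\<forall>g \<in> carrier G. \<forall>u \<in> verts T. \<forall>v \<in> verts T.
        {\<phi> g u, \<phi> g v} \<in> edges T \<longleftrightarrow> {u, v} \<in> edges T)"

definition invariant_subtree ::
    "('g, 'm) monoid_scheme \<Rightarrow> 't ugraph \<Rightarrow> ('g \<Rightarrow> 't \<Rightarrow> 't) \<Rightarrow> 't ugraph \<Rightarrow> bool" where
  "invariant_subtree G T \<phi> S \<longleftrightarrow> is_subgraph S T \<and> is_tree S \<and>
     (\<forall>g \<in> carrier G. \<phi> g ` verts S = verts S \<and> (\<lambda>e. \<phi> g ` e) ` edges S = edges S)"

definition minimal_action ::
    "('g, 'm) monoid_scheme \<Rightarrow> 't ugraph \<Rightarrow> ('g \<Rightarrow> 't \<Rightarrow> 't) \<Rightarrow> bool" where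
  "minimal_action G T \<phi> \<longleftrightarrow> (\<forall>S. invariant_subtree G T \<phi> S \<longrightarrow> S = T)"

text \<open>
  Elements may invert edges, so the points of the realization matter here, not only the vertices.
  The point with coordinates \<open>p\<close> is fixed by all elements iff \<open>p\<close> is constant on orbits of vertices.
\<close>

definition nontrivial_action ::
    "('g, 'm) monoid_scheme \<Rightarrow> 't ugraph \<Rightarrow> ('g \<Rightarrow> 't \<Rightarrow> 't) \<Rightarrow> bool" where
  "nontrivial_action G T \<phi> \<longleftrightarrow>
     \<not> (\<exists>p \<in> realization T. \<forall>g \<in> carrier G. \<forall>x \<in> verts T. p (\<phi> g x) = p x)"

definition edge_stabilizer ::
    "('g, 'm) monoid_scheme \<Rightarrow> ('g \<Rightarrow> 't \<Rightarrow> 't) \<Rightarrow> 't set \<Rightarrow> 'g set" where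
  "edge_stabilizer G \<phi> e = stabilizer G (\<lambda>g e. \<phi> g ` e) e"


section \<open>Group presentations\<close>

text \<open>The letter \<open>(x, True)\<close> stands for the generator \<open>x\<close> and \<open>(x, False)\<close> for its inverse.\<close>

type_synonym 'a word = "('a \<times> bool) list"

definition words :: "'a set \<Rightarrow> 'a word set" where
  "words X = lists (X \<times> UNIV)"

inductive pres_step :: "'a set \<Rightarrow> 'a word set \<Rightarrow> 'a word \<Rightarrow> 'a word \<Rightarrow> bool"
  for X R where
  cancel: "u \<in> words X \<Longrightarrow> v \<in> words X \<Longrightarrow> x \<in> X \<Longrightarrow>
             pres_step X R (u @ [(x, b), (x, \<not> b)] @ v) (u @ v)"
| relator: "u \<in> words X \<Longrightarrow> v \<in> words X \<Longrightarrow> r \<in> R \<Longrightarrow>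
             pres_step X R (u @ r @ v) (u @ v)"

definition pres_rel :: "'a set \<Rightarrow> 'a word set \<Rightarrow> ('a word \<times> 'a word) set" where
  "pres_rel X R =
     {(w, w'). w \<in> words X \<and> w' \<in> words X \<and> equivclp (pres_step X R) w w'}"

definition presented_group :: "'a set \<Rightarrow> 'a word set \<Rightarrow> 'a word set monoid" where
  "presented_group X R =
     \<lparr>carrier = words X // pres_rel X R,
      mult = \<lambda>A B. pres_rel X R `` {a @ b | a b. a \<in> A \<and> b \<in> B},
      one = pres_rel X R `` {[]}\<rparr>"

lemma words_append [simp]: "u @ v \<in> words X \<longleftrightarrow> u \<in> words X \<and> v \<in> words X"
  by (simp add: words_def)

lemma words_Nil [simp]: "[] \<in> words X"
  by (simp add: words_def)

lemma words_Cons [simp]: "(x, b) # w \<in> words X \<longleftrightarrow> x \<in> X \<and> w \<in> words X"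
  by (simp add: words_def)

lemma equiv_pres_rel: "equiv (words X) (pres_rel X R)"
proof (rule equivI)
  show "pres_rel X R \<subseteq> words X \<times> words X"
    by (auto simp: pres_rel_def)
  show "refl_on (words X) (pres_rel X R)"
    by (auto simp: pres_rel_def refl_on_def)
  show "sym (pres_rel X R)"
    by (auto simp: pres_rel_def sym_def intro: equivclp_sym)
  show "trans (pres_rel X R)"
    unfolding pres_rel_def trans_def by (blast intro: equivclp_trans)
qed

lemma pres_step_context:
  assumes "pres_step X R w w'" "u \<in> words X" "v \<in> words X"
  shows "pres_step X R (u @ w @ v) (u @ w' @ v)"
  using assms(1)
proof cases
  case (cancel a c x b)
  then show ?thesis
    using pres_step.cancel[of "u @ a" X "c @ v" x R b] assms by simp
next
  case (relator a c r)
  then show ?thesis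
    using pres_step.relator[of "u @ a" X "c @ v" r R] assms by simp
qed

lemma equivclp_pres_context:
  assumes "equivclp (pres_step X R) w w'" "u \<in> words X" "v \<in> words X"
  shows "equivclp (pres_step X R) (u @ w @ v) (u @ w' @ v)"
  using assms(1)
proof (induction rule: equivclp_induct)
  case base
  then show ?case by simp
next
  case (step y z)
  then have "equivclp (pres_step X R) (u @ y @ v) (u @ z @ v)"
    using pres_step_context[OF _ assms(2,3)] by (blast intro: equivclp_sym)
  then show ?case using step.IH by (blast intro: equivclp_trans)
qed

lemma pres_rel_append:
  assumes "(a, a') \<in> pres_rel X R" "(b, b') \<in> pres_rel X R"
  shows "(a @ b, a' @ b') \<in> pres_rel X R"
proof -
  have "equivclp (pres_step X R) (a @ b) (a' @ b)"
    using equivclp_pres_context[of X R a a' "[]" b] assms by (simp add: pres_rel_def)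
  moreover have "equivclp (pres_step X R) (a' @ b) (a' @ b')"
    using equivclp_pres_context[of X R b b' a' "[]"] assms by (simp add: pres_rel_def)
  ultimately show ?thesis
    using assms by (auto simp: pres_rel_def intro: equivclp_trans)
qed

definition word_inv :: "'a word \<Rightarrow> 'a word" where
  "word_inv w = rev (map (\<lambda>(x, b). (x, \<not> b)) w)"

lemma word_inv_words [simp]: "w \<in> words X \<Longrightarrow> word_inv w \<in> words X"
  by (induction w) (auto simp: word_inv_def)

lemma word_inv_left: "w \<in> words X \<Longrightarrow> (word_inv w @ w, []) \<in> pres_rel X R"
proof (induction w)
  case Nil
  then show ?case by (simp add: word_inv_def pres_rel_def)
next
  case (Cons l w)
  obtain x b where l: "l = (x, b)" by (cases l)
  have w: "x \<in> X" "w \<in> words X" using Cons.prems l by auto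
  have "pres_step X R (word_inv w @ [(x, \<not> b), (x, \<not> \<not> b)] @ w) (word_inv w @ w)"
    using w by (intro pres_step.cancel) auto
  then have "equivclp (pres_step X R) (word_inv (l # w) @ l # w) (word_inv w @ w)"
    by (simp add: l word_inv_def r_into_equivclp)
  then show ?case
    using Cons.IH[OF w(2)] Cons.prems
    by (auto simp: pres_rel_def intro: equivclp_trans)
qed

lemma presented_mult:
  assumes "a \<in> words X" "b \<in> words X"
  shows "pres_rel X R `` {a} \<otimes>\<^bsub>presented_group X R\<^esub> pres_rel X R `` {b} = pres_rel X R `` {a @ b}"
proof -
  note eq = equiv_pres_rel[of X R]
  have self: "a \<in> pres_rel X R `` {a}" "b \<in> pres_rel X R `` {b}"
    using assms equiv_class_self[OF eq] by auto
  let ?P = "{a' @ b' | a' b'. a' \<in> pres_rel X R `` {a} \<and> b' \<in> pres_rel X R `` {b}}"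
  have "pres_rel X R `` {c} = pres_rel X R `` {a @ b}" if "c \<in> ?P" for c
  proof -
    have "(a @ b, c) \<in> pres_rel X R"
      using that by (auto intro: pres_rel_append)
    from equiv_class_eq[OF eq this] show ?thesis by simp
  qed
  moreover have "?P \<noteq> {}"
    using self by blast
  ultimately have "pres_rel X R `` ?P = pres_rel X R `` {a @ b}"
    by (subst Image_eq_UN) (rule SUP_eq_const)
  then show ?thesis
    by (simp add: presented_group_def)
qed

theorem group_presented_group: "group (presented_group X R)"
proof (rule groupI)
  let ?G = "presented_group X R"
  have rep: "\<exists>a \<in> words X. A = pres_rel X R `` {a}" if "A \<in> carrier ?G" for A
    using that by (auto simp: presented_group_def elim: quotientE)
  have cl: "pres_rel X R `` {a} \<in> carrier ?G" if "a \<in> words X" for a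
    using that by (simp add: presented_group_def quotientI)
  have one: "\<one>\<^bsub>?G\<^esub> = pres_rel X R `` {[]}"
    by (simp add: presented_group_def)
  show "\<one>\<^bsub>?G\<^esub> \<in> carrier ?G"
    by (simp add: one cl)
  show "A \<otimes>\<^bsub>?G\<^esub> B \<in> carrier ?G" if "A \<in> carrier ?G" "B \<in> carrier ?G" for A B
    using rep[OF that(1)] rep[OF that(2)] by (auto simp: presented_mult cl)
  show "A \<otimes>\<^bsub>?G\<^esub> B \<otimes>\<^bsub>?G\<^esub> C = A \<otimes>\<^bsub>?G\<^esub> (B \<otimes>\<^bsub>?G\<^esub> C)"
    if "A \<in> carrier ?G" "B \<in> carrier ?G" "C \<in> carrier ?G" for A B C
    using rep[OF that(1)] rep[OF that(2)] rep[OF that(3)] by (auto simp: presented_mult)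
  show "\<one>\<^bsub>?G\<^esub> \<otimes>\<^bsub>?G\<^esub> A = A" if "A \<in> carrier ?G" for A
    using rep[OF that] by (auto simp: presented_mult one)
  show "\<exists>B \<in> carrier ?G. B \<otimes>\<^bsub>?G\<^esub> A = \<one>\<^bsub>?G\<^esub>" if A: "A \<in> carrier ?G" for A
  proof -
    obtain a where a: "a \<in> words X" "A = pres_rel X R `` {a}" using rep[OF A] by blast
    have "pres_rel X R `` {word_inv a @ a} = pres_rel X R `` {[]}"
      using word_inv_left[OF a(1)] equiv_class_eq[OF equiv_pres_rel] by blast
    then have "pres_rel X R `` {word_inv a} \<otimes>\<^bsub>?G\<^esub> A = \<one>\<^bsub>?G\<^esub>"
      using a by (simp add: presented_mult one)
    then show ?thesis by (rule bexI) (simp add: cl a(1))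
  qed
qed


section \<open>Right-angled Artin groups\<close>

definition commutator_word :: "'a \<Rightarrow> 'a \<Rightarrow> 'a word" where
  "commutator_word u v = [(u, True), (v, True), (u, False), (v, False)]"

definition raag_relators :: "'a ugraph \<Rightarrow> 'a word set" where
  "raag_relators G = {commutator_word u v | u v. {u, v} \<in> edges G}"

definition raag :: "'a ugraph \<Rightarrow> 'a word set monoid" where
  "raag G = presented_group (verts G) (raag_relators G)"

definition raag_gen :: "'a ugraph \<Rightarrow> 'a \<Rightarrow> 'a word set" where
  "raag_gen G v = pres_rel (verts G) (raag_relators G) `` {[(v, True)]}"

text \<open>For an induced subgraph \<open>H\<close> of \<open>G\<close>, the copy of the group of \<open>H\<close> inside that of \<open>G\<close>.\<close>

definition raag_subgroup :: "'a ugraph \<Rightarrow> 'a ugraph \<Rightarrow> 'a word set set" where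
  "raag_subgroup G H = generate (raag G) (raag_gen G ` verts H)"

end

theory Submission
  imports Defs
begin

text \<open>
  The group enters only through the automorphisms of the tree by which the generators, the vertices
  of \<open>\<Gamma>\<close>, act, and through the fact that adjacent generators commute. The aim is an edge \<open>e\<close> and two
  non-empty disjoint sets \<open>A\<close>, \<open>B\<close> of generators without an edge of \<open>\<Gamma>\<close> between them such that every
  other generator preserves \<open>e\<close>; the other generators then span \<open>\<Lambda>\<close>. What produces \<open>A\<close> and \<open>B\<close> depends
  on how single generators act.

  \<^item> If a generator \<open>v\<close> inverts an edge \<open>e\<close>, then \<open>e\<close> is the only edge that it inverts, so whatever
    commutes with \<open>v\<close> preserves \<open>e\<close>. Hence \<open>A = {v}\<close>, and \<open>B\<close> consists of the generators that are neither
    \<open>v\<close> nor adjacent to it. Were \<open>B\<close> empty, the midpoint of \<open>e\<close> would be a global fixed point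
    (\<open>splits_if_inversion\<close>).

  \<^item> If a generator \<open>v\<close> neither inverts an edge nor fixes a vertex, then it translates an axis \<open>f\<close>
    (\<open>axis_exists\<close>), and whatever commutes with a nontrivial translation of \<open>f\<close> translates \<open>f\<close> or fixes it
    pointwise (\<open>commuting_translates_axis\<close>). Hence \<open>A\<close> consists of the generators that translate \<open>f\<close>
    nontrivially, \<open>B\<close> of those that do not act on \<open>f\<close> by a translation, and the others fix every edge
    of \<open>f\<close>. Were \<open>B\<close> empty, \<open>f\<close> would be an invariant subtree and \<open>T\<close> a line
    (\<open>splits_if_translation\<close>).

  \<^item> If every generator fixes a vertex, then each edge \<open>e\<close> divides the generators that move it according
    to the side of \<open>e\<close> on which their fixed vertices lie, and commuting generators lie on the same side
    (\<open>splits_if_pulled_both_ways\<close>). So it suffices that both sides occur for some edge. Otherwise every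
    edge points towards its one side that occurs, and the arrows lead either to a vertex that all
    generators fix or to an end of \<open>T\<close>. The first is excluded, as the action is nontrivial. In the
    second case all generators fix that end and preserve its horospheres, so that a horoball is a
    proper invariant subtree, against minimality (\<open>no_equivariant_parent_map\<close>). This argument covers
    infinite \<open>\<Gamma>\<close>.

  The geometry of \<open>T\<close> is expressed by half-trees. Removal of an edge \<open>{a, b}\<close> leaves two components;
  \<open>side a b\<close> is the one that contains \<open>b\<close>, and an adjacent pair of vertices can change sides only by
  running through that edge (\<open>crossing_edge\<close>).
\<close>


section \<open>Half-trees\<close>

lemma rtrancl_distinct_path:
  assumes "(x, y) \<in> R\<^sup>*"
  shows "\<exists>xs. distinct xs \<and> xs \<noteq> [] \<and> hd xs = x \<and> last xs = y \<and>
           (\<forall>i. Suc i < length xs \<longrightarrow> (xs ! i, xs ! Suc i) \<in> R)"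
  using assms
proof (induction rule: rtrancl_induct)
  case base
  then show ?case by (intro exI[of _ "[x]"]) auto
next
  case (step y z)
  then obtain xs where xs: "distinct xs" "xs \<noteq> []" "hd xs = x" "last xs = y"
    "\<And>i. Suc i < length xs \<Longrightarrow> (xs ! i, xs ! Suc i) \<in> R" by blast
  show ?case
  proof (cases "z \<in> set xs")
    case True
    then obtain ys zs where split: "xs = ys @ z # zs" by (meson split_list)
    have "(ys @ [z]) ! i = xs ! i" if "i < length (ys @ [z])" for i
      using that by (auto simp: split nth_append)
    then have "\<forall>i. Suc i < length (ys @ [z]) \<longrightarrow> ((ys @ [z]) ! i, (ys @ [z]) ! Suc i) \<in> R"
      using xs(5) by (auto simp: split)
    then show ?thesis
      using xs(1,3) by (intro exI[of _ "ys @ [z]"]) (auto simp: split hd_append)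
  next
    case False
    have "((xs @ [z]) ! i, (xs @ [z]) ! Suc i) \<in> R" if i: "Suc i < length (xs @ [z])" for i
    proof (cases "Suc i < length xs")
      case True
      then show ?thesis using xs(5)[OF True] by (simp add: nth_append)
    next
      case False
      then have "i = length xs - 1" "Suc i = length xs" using i by auto
      then show ?thesis using xs(2,4) step(2) by (simp add: nth_append last_conv_nth)
    qed
    then show ?thesis
      using xs False by (intro exI[of _ "xs @ [z]"]) auto
  qed
qed

locale tree =
  fixes T :: "'t ugraph"
  assumes tree: "is_tree T"
begin

abbreviation V :: "'t set" where "V \<equiv> verts T"

abbreviation adj :: "'t \<Rightarrow> 't \<Rightarrow> bool" where "adj x y \<equiv> {x, y} \<in> edges T"

abbreviation adjrel :: "('t \<times> 't) set" where "adjrel \<equiv> {(u, w). adj u w}"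

definition side :: "'t \<Rightarrow> 't \<Rightarrow> 't set" where
  "side a b = {x. (b, x) \<in> {(u, w). adj u w \<and> {u, w} \<noteq> {a, b}}\<^sup>*}"

lemma adj_sym: "adj x y \<longleftrightarrow> adj y x"
  by (simp add: insert_commute)

lemma adjD: "adj x y \<Longrightarrow> x \<in> V \<and> y \<in> V \<and> x \<noteq> y"
  using tree unfolding is_tree_def simple_graph_def by (fastforce simp: doubleton_eq_iff)

lemma edge_cases:
  assumes "e \<in> edges T" obtains x y where "e = {x, y}" "adj x y"
  using assms tree unfolding is_tree_def simple_graph_def by metis

lemma edge_finite: "e \<in> edges T \<Longrightarrow> e \<subseteq> V \<and> finite e \<and> e \<noteq> {}"
  using tree unfolding is_tree_def simple_graph_def by fastforce

lemma verts_nonempty: "V \<noteq> {}"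
  using tree unfolding is_tree_def connected_graph_def components_def by (auto simp: quotient_def)

lemma connected:
  assumes "x \<in> V" "y \<in> V"
  shows "(x, y) \<in> adjrel\<^sup>*"
proof -
  obtain C where C: "V // walk_rel T = {C}"
    using tree unfolding is_tree_def connected_graph_def components_def by blast
  have "walk_rel T `` {x} = walk_rel T `` {y}"
    using assms C by (metis quotientI singletonD)
  moreover have "y \<in> walk_rel T `` {y}" using assms by (simp add: walk_rel_def)
  ultimately show ?thesis by (auto simp: walk_rel_def)
qed

text \<open>
  A simple path from \<open>a\<close> to \<open>b\<close> that avoids the edge \<open>{a, b}\<close> would close up to a cycle. This is
  how acyclicity makes the two sides of an edge disjoint.
\<close>

lemma no_bypass:
  assumes "adj a b"
  shows "(a, b) \<notin> {(u, w). adj u w \<and> {u, w} \<noteq> {a, b}}\<^sup>*"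
proof
  assume "(a, b) \<in> {(u, w). adj u w \<and> {u, w} \<noteq> {a, b}}\<^sup>*"
  from rtrancl_distinct_path[OF this] obtain xs where xs: "distinct xs" "xs \<noteq> []"
    "hd xs = a" "last xs = b"
    "\<And>i. Suc i < length xs \<Longrightarrow> adj (xs ! i) (xs ! Suc i) \<and> {xs ! i, xs ! Suc i} \<noteq> {a, b}"
    by auto
  have "length xs \<noteq> 1" using xs adjD[OF assms] by (auto simp: length_Suc_conv)
  moreover have "length xs \<noteq> 2"
    using xs by (auto simp: length_Suc_conv numeral_2_eq_2)
  ultimately have "3 \<le> length xs" using xs(2) by (cases xs) (auto simp: Suc_le_eq neq_Nil_conv)
  then have "is_cycle T xs" using xs assms by (simp add: is_cycle_def insert_commute)
  then show False using tree by (auto simp: is_tree_def)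
qed

lemma side_self: "b \<in> side a b"
  by (simp add: side_def)

lemma side_step: "x \<in> side a b \<Longrightarrow> adj x y \<Longrightarrow> {x, y} \<noteq> {a, b} \<Longrightarrow> y \<in> side a b"
  unfolding side_def by (auto intro: rtrancl_into_rtrancl)

lemma side_cover:
  assumes "adj a b" "x \<in> V"
  shows "x \<in> side a b \<or> x \<in> side b a"
proof -
  have "(b, x) \<in> adjrel\<^sup>*" using connected adjD assms by blast
  then show ?thesis
  proof (induction rule: rtrancl_induct)
    case base
    then show ?case by (simp add: side_self)
  next
    case (step y z)
    show ?case
    proof (cases "{y, z} = {a, b}")
      case True
      then show ?thesis using side_self by (auto simp: doubleton_eq_iff)
    next
      case False
      then show ?thesis using step side_step[of y _ _ z] by (auto simp: insert_commute)
    qed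
  qed
qed

lemma side_disjoint:
  assumes "adj a b" "x \<in> side a b"
  shows "x \<notin> side b a"
proof
  let ?R = "{(u, w). adj u w \<and> {u, w} \<noteq> {a, b}}"
  assume "x \<in> side b a"
  then have "(a, x) \<in> ?R\<^sup>*" by (simp add: side_def insert_commute)
  moreover have "(x, b) \<in> ?R\<^sup>*"
  proof -
    have "sym ?R" by (auto simp: sym_def insert_commute)
    then show ?thesis using assms(2) by (metis (no_types, lifting) mem_Collect_eq side_def sym_rtrancl symD)
  qed
  ultimately show False using no_bypass[OF assms(1)] by (meson rtrancl_trans)
qed

lemma side_swap: "adj a b \<Longrightarrow> x \<in> V \<Longrightarrow> x \<in> side b a \<longleftrightarrow> x \<notin> side a b"
  using side_cover side_disjoint by blast

lemma start_notin_side: "adj a b \<Longrightarrow> a \<notin> side a b"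
  using side_disjoint[of a b a] side_self by blast

lemma crossing_edge:
  assumes "adj x y" "x \<notin> side a b" "y \<in> side a b" "adj a b"
  shows "x = a \<and> y = b"
proof -
  have "{x, y} = {a, b}"
    using assms side_step[of y a b x] by (auto simp: insert_commute)
  then show ?thesis using assms start_notin_side by (auto simp: doubleton_eq_iff)
qed

lemma walk_crosses:
  assumes "adj a b" "\<And>i. i < n \<Longrightarrow> adj (p i) (p (Suc i))"
    and "p 0 \<notin> side a b" "p n \<in> side a b"
  shows "\<exists>i<n. p i = a \<and> p (Suc i) = b"
  using assms(2-)
proof (induction n)
  case 0
  then show ?case by simp
next
  case (Suc n)
  show ?case
  proof (cases "p n \<in> side a b")
    case True
    then show ?thesis using Suc.IH Suc.prems by (meson less_SucI)
  next
    case False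
    then show ?thesis using crossing_edge Suc.prems assms(1) by blast
  qed
qed

text \<open>
  Local geodesics in a tree are global: a walk without backtracking never returns through an edge that
  it has traversed. It could do so only from the endpoint \<open>f (Suc j)\<close>, which it has left for good by
  the same statement about the following edge.
\<close>

lemma nonbacktracking_side:
  assumes step: "\<And>i. adj (f i) (f (Suc i))" and nb: "\<And>i. f i \<noteq> f (Suc (Suc i))"
  shows "f (Suc (j + n)) \<in> side (f j) (f (Suc j))"
proof (induction n arbitrary: j rule: less_induct)
  case (less n)
  show ?case
  proof (cases n)
    case 0
    then show ?thesis by (simp add: side_self)
  next
    case (Suc m)
    have IH: "f (Suc (j + m)) \<in> side (f j) (f (Suc j))" using less[of m j] Suc by simp
    have "{f (Suc (j + m)), f (Suc (Suc (j + m)))} \<noteq> {f j, f (Suc j)}"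
    proof
      assume eq: "{f (Suc (j + m)), f (Suc (Suc (j + m)))} = {f j, f (Suc j)}"
      have "f (Suc (j + m)) \<noteq> f j"
        using IH start_notin_side step by metis
      then have *: "f (Suc (j + m)) = f (Suc j)" "f (Suc (Suc (j + m))) = f j"
        using eq by (auto simp: doubleton_eq_iff)
      show False
      proof (cases m)
        case 0
        then show ?thesis using * nb[of j] by simp
      next
        case (Suc k)
        \<comment> \<open>the walk has left \<open>f (Suc j)\<close> through its next edge and would have to be back there\<close>
        then have "f (Suc j) \<in> side (f (Suc j)) (f (Suc (Suc j)))"
          using *(1) less[of k "Suc j"] \<open>n = Suc m\<close> by simp
        then show ?thesis using start_notin_side step by blast
      qed
    qed
    then show ?thesis using IH side_step[OF _ step] Suc by simp
  qed
qed

lemma nonbacktracking_inj: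
  assumes step: "\<And>i. adj (f i) (f (Suc i))" and nb: "\<And>i. f i \<noteq> f (Suc (Suc i))"
    and "j < m"
  shows "f j \<noteq> f m"
proof -
  obtain n where "m = Suc (j + n)" using \<open>j < m\<close> less_imp_Suc_add by auto
  then have "f m \<in> side (f j) (f (Suc j))" using nonbacktracking_side[of f j n] step nb by blast
  then show ?thesis using start_notin_side[OF step[of j]] by metis
qed

lemma side_subset:
  assumes "adj a b" "adj a c" "b \<noteq> c"
  shows "side a b \<subseteq> side c a"
proof
  fix x assume "x \<in> side a b"
  then have "(b, x) \<in> {(u, w). adj u w \<and> {u, w} \<noteq> {a, b}}\<^sup>*" by (simp add: side_def)
  then have "x \<in> side c a \<and> x \<in> side a b"
  proof (induction rule: rtrancl_induct)
    case base
    have "b \<in> side c a"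
      using side_step[OF side_self assms(1)] assms adjD
      by (metis doubleton_eq_iff)
    then show ?case by (simp add: side_self)
  next
    case (step y z)
    have z: "z \<in> side a b" using step side_step[of y a b z] by blast
    have "a \<noteq> y" using step start_notin_side assms(1) by blast
    moreover have "a \<noteq> z" using z start_notin_side assms(1) by blast
    ultimately have "{y, z} \<noteq> {c, a}" by (auto simp: doubleton_eq_iff)
    then show ?case using step z side_step[of y c a z] by auto
  qed
  then show "x \<in> side c a" by simp
qed

lemma first_step:
  assumes "x \<in> V" "y \<in> V" "x \<noteq> y"
  shows "\<exists>b. adj x b \<and> y \<in> side x b"
proof -
  have "(x, y) \<in> adjrel\<^sup>*" using connected assms by blast
  then have "y = x \<or> (\<exists>b. adj x b \<and> y \<in> side x b)"
  proof (induction rule: rtrancl_induct)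
    case base
    then show ?case by simp
  next
    case (step y z)
    then have yz: "adj y z" by simp
    show ?case
    proof (cases "y = x \<or> z = x")
      case True
      then show ?thesis using yz side_self by auto
    next
      case False
      then obtain b where "adj x b" "y \<in> side x b" using step by blast
      then show ?thesis using False side_step[of y x b z] yz by (auto simp: doubleton_eq_iff)
    qed
  qed
  then show ?thesis using assms by blast
qed

definition separating :: "'t \<Rightarrow> 't \<Rightarrow> ('t \<times> 't) set" where
  "separating x y = {(a, b). adj a b \<and> x \<notin> side a b \<and> y \<in> side a b}"

text \<open>
  A walk from \<open>x\<close> to \<open>y\<close> traverses every edge that separates them. This finiteness replaces estimates
  with the metric when two lines are compared at infinity.
\<close>

lemma finite_separating:
  assumes "x \<in> V" "y \<in> V"
  shows "finite (separating x y)"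
proof -
  have "(x, y) \<in> adjrel\<^sup>*" using connected assms by blast
  then show ?thesis
  proof (induction rule: rtrancl_induct)
    case base
    then show ?case by (simp add: separating_def)
  next
    case (step y z)
    have "separating x z \<subseteq> insert (y, z) (separating x y)"
      using step crossing_edge[of y z] by (auto simp: separating_def)
    then show ?case using step.IH finite_subset by blast
  qed
qed


section \<open>Automorphisms\<close>

definition automorphism :: "('t \<Rightarrow> 't) \<Rightarrow> bool" where
  "automorphism \<alpha> \<longleftrightarrow> bij_betw \<alpha> V V \<and> (\<forall>x\<in>V. \<forall>y\<in>V. adj (\<alpha> x) (\<alpha> y) \<longleftrightarrow> adj x y)"

lemma automorphism_verts: "automorphism \<alpha> \<Longrightarrow> x \<in> V \<Longrightarrow> \<alpha> x \<in> V"
  by (auto simp: automorphism_def bij_betw_def)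

lemma automorphism_eq: "automorphism \<alpha> \<Longrightarrow> x \<in> V \<Longrightarrow> y \<in> V \<Longrightarrow> \<alpha> x = \<alpha> y \<longleftrightarrow> x = y"
  by (auto simp: automorphism_def bij_betw_def inj_on_def)

lemma automorphism_surj: "automorphism \<alpha> \<Longrightarrow> y \<in> V \<Longrightarrow> \<exists>x\<in>V. \<alpha> x = y"
  unfolding automorphism_def bij_betw_def by (metis imageE)

lemma automorphism_adj: "automorphism \<alpha> \<Longrightarrow> adj x y \<Longrightarrow> adj (\<alpha> x) (\<alpha> y)"
  using adjD by (auto simp: automorphism_def)

lemma automorphism_adj_iff:
  "automorphism \<alpha> \<Longrightarrow> x \<in> V \<Longrightarrow> y \<in> V \<Longrightarrow> adj (\<alpha> x) (\<alpha> y) \<longleftrightarrow> adj x y"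
  by (auto simp: automorphism_def)

lemma side_image:
  assumes \<alpha>: "automorphism \<alpha>" and ab: "adj a b" and "x \<in> side a b"
  shows "\<alpha> x \<in> side (\<alpha> a) (\<alpha> b)"
proof -
  have "(b, x) \<in> {(u, w). adj u w \<and> {u, w} \<noteq> {a, b}}\<^sup>*" using assms by (simp add: side_def)
  then show ?thesis
  proof (induction rule: rtrancl_induct)
    case base
    then show ?case by (simp add: side_self)
  next
    case (step y z)
    then have yz: "adj y z" "{y, z} \<noteq> {a, b}" by auto
    then have "{\<alpha> y, \<alpha> z} \<noteq> {\<alpha> a, \<alpha> b}"
      using adjD[OF ab] adjD[OF yz(1)] by (auto simp: doubleton_eq_iff automorphism_eq[OF \<alpha>])
    then show ?case using step.IH side_step automorphism_adj[OF \<alpha> yz(1)] by blast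
  qed
qed

lemma side_image_iff:
  assumes \<alpha>: "automorphism \<alpha>" and ab: "adj a b" and x: "x \<in> V"
  shows "\<alpha> x \<in> side (\<alpha> a) (\<alpha> b) \<longleftrightarrow> x \<in> side a b"
proof
  assume "\<alpha> x \<in> side (\<alpha> a) (\<alpha> b)"
  then have "\<alpha> x \<notin> side (\<alpha> b) (\<alpha> a)"
    using side_disjoint automorphism_adj[OF \<alpha> ab] by blast
  then have "x \<notin> side b a" using side_image[OF \<alpha>, of b a] ab adj_sym by blast
  then show "x \<in> side a b" using side_cover[OF ab x] by blast
qed (rule side_image[OF \<alpha> ab])

lemma relpow_verts: "(x, y) \<in> adjrel ^^ n \<Longrightarrow> x \<in> V \<Longrightarrow> y \<in> V"
  by (cases n) (use adjD in auto)

lemma relpow_image_iff: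
  assumes \<alpha>: "automorphism \<alpha>" and "x \<in> V" "y \<in> V"
  shows "(\<alpha> x, \<alpha> y) \<in> adjrel ^^ n \<longleftrightarrow> (x, y) \<in> adjrel ^^ n"
  using assms(3)
proof (induction n arbitrary: y)
  case 0
  then show ?case using automorphism_eq[OF \<alpha>] assms(2) by auto
next
  case (Suc n)
  show ?case
  proof
    assume "(\<alpha> x, \<alpha> y) \<in> adjrel ^^ Suc n"
    then obtain z where z: "(\<alpha> x, z) \<in> adjrel ^^ n" "adj z (\<alpha> y)" by auto
    obtain w where "w \<in> V" "z = \<alpha> w" using automorphism_surj[OF \<alpha>] adjD[OF z(2)] by blast
    then show "(x, y) \<in> adjrel ^^ Suc n"
      using z Suc automorphism_adj_iff[OF \<alpha>] by auto
  next
    assume "(x, y) \<in> adjrel ^^ Suc n"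
    then obtain z where z: "(x, z) \<in> adjrel ^^ n" "adj z y" by auto
    then show "(\<alpha> x, \<alpha> y) \<in> adjrel ^^ Suc n"
      using Suc.IH[of z] adjD automorphism_adj[OF \<alpha>] by auto
  qed
qed

text \<open>
  The basic fact about fixed points. A shortest walk from \<open>y\<close> to \<open>x\<close> and its image both start at
  \<open>y = \<alpha> y\<close> and both run through the edge from \<open>a\<close> to \<open>b\<close>. Since they are shortest walks, they do so at
  the same time, so \<open>\<alpha>\<close> fixes the edge. With \<open>\<alpha> x = x\<close> this says that an automorphism with fixed
  vertices on both sides of an edge fixes the edge; the form with \<open>\<alpha> x\<close> serves to compare
  the fixed vertices of commuting automorphisms.
\<close>

lemma fixes_separating_edge:
  assumes \<alpha>: "automorphism \<alpha>" and ab: "adj a b"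
    and y: "y \<in> V" "\<alpha> y = y" "y \<notin> side a b"
    and x: "x \<in> V" "x \<in> side a b" "\<alpha> x \<in> side a b"
  shows "\<alpha> a = a \<and> \<alpha> b = b"
proof -
  have ex: "\<exists>n. (y, x) \<in> adjrel ^^ n" using connected[OF y(1) x(1)] by (simp add: rtrancl_power)
  define n where "n = (LEAST n. (y, x) \<in> adjrel ^^ n)"
  have n: "(y, x) \<in> adjrel ^^ n" "\<And>m. (y, x) \<in> adjrel ^^ m \<Longrightarrow> n \<le> m"
    unfolding n_def using ex by (auto intro: LeastI_ex Least_le)
  obtain p where p: "p 0 = y" "p n = x" "\<And>i. i < n \<Longrightarrow> adj (p i) (p (Suc i))"
    using n(1) by (auto simp: relpow_fun_conv)
  have pre: "(y, p j) \<in> adjrel ^^ j" if "j \<le> n" for j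
    using p that by (auto simp: relpow_fun_conv)
  have pV: "p j \<in> V" if "j \<le> n" for j using pre[OF that] relpow_verts y(1) by blast
  have short: "j \<le> m" if "(y, p j) \<in> adjrel ^^ m" "j \<le> n" for j m
  proof -
    have "(p j, x) \<in> adjrel ^^ (n - j)"
      unfolding relpow_fun_conv using p that(2) by (intro exI[of _ "\<lambda>i. p (j + i)"]) auto
    then have "(y, x) \<in> adjrel ^^ (m + (n - j))" using that(1) by (auto simp: relpow_add)
    then show ?thesis using n(2) that(2) by fastforce
  qed
  obtain i where i: "i < n" "p i = a" "p (Suc i) = b"
    using walk_crosses[OF ab, of n p] p y x by auto
  obtain j where j: "j < n" "\<alpha> (p j) = a" "\<alpha> (p (Suc j)) = b"
    using walk_crosses[OF ab, of n "\<lambda>i. \<alpha> (p i)"] p y x automorphism_adj[OF \<alpha>] by auto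
  have "(\<alpha> y, \<alpha> (p j)) \<in> adjrel ^^ i" using pre[of i] i j y(2) by simp
  then have "(y, p j) \<in> adjrel ^^ i" using relpow_image_iff[OF \<alpha>] y(1) pV j(1) by simp
  then have "j \<le> i" using short j(1) by simp
  have "(\<alpha> y, \<alpha> (p j)) \<in> adjrel ^^ j" using relpow_image_iff[OF \<alpha>] y(1) pV pre j(1) by simp
  then have "(y, p i) \<in> adjrel ^^ j" using y(2) i j by simp
  then have "i = j" using short[of i j] i(1) \<open>j \<le> i\<close> by simp
  then show ?thesis using i j by simp
qed

text \<open>
  The automorphism \<open>\<alpha>\<close> inverts the edge \<open>{x, y}\<close>, hence also the image of that edge under \<open>\<beta>\<close>. If the
  image were another edge, it would lie on one side of \<open>{x, y}\<close>, whereas \<open>\<alpha>\<close> exchanges the two sides.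
\<close>

lemma commuting_preserves_inverted_edge:
  assumes \<alpha>: "automorphism \<alpha>" and \<beta>: "automorphism \<beta>"
    and comm: "\<And>x. x \<in> V \<Longrightarrow> \<alpha> (\<beta> x) = \<beta> (\<alpha> x)"
    and xy: "adj x y" "\<alpha> x = y" "\<alpha> y = x"
  shows "\<beta> ` {x, y} = {x, y}"
proof (rule ccontr)
  assume ne: "\<beta> ` {x, y} \<noteq> {x, y}"
  have V: "x \<in> V" "y \<in> V" using adjD[OF xy(1)] by auto
  have adj: "adj (\<beta> x) (\<beta> y)" using automorphism_adj[OF \<beta> xy(1)] .
  have \<beta>V: "\<beta> x \<in> V" "\<beta> y \<in> V" using adjD[OF adj] by auto
  have im: "\<alpha> (\<beta> x) = \<beta> y" "\<alpha> (\<beta> y) = \<beta> x" using comm V xy by simp_all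
  have same: "\<beta> x \<in> side x y \<longleftrightarrow> \<beta> y \<in> side x y"
    using side_step[of "\<beta> x" x y "\<beta> y"] side_step[of "\<beta> y" x y "\<beta> x"] adj ne
    by (auto simp: insert_commute)
  moreover have "\<beta> y \<in> side y x \<longleftrightarrow> \<beta> x \<in> side x y"
    using side_image_iff[OF \<alpha> xy(1) \<beta>V(1)] xy im by simp
  ultimately show False using side_swap[OF xy(1) \<beta>V(2)] by blast
qed


section \<open>Axes\<close>

definition geodesic_line :: "(int \<Rightarrow> 't) \<Rightarrow> bool" where
  "geodesic_line f \<longleftrightarrow> (\<forall>i. adj (f i) (f (i + 1)) \<and> f i \<noteq> f (i + 2))"

lemma geodesic_line_side:
  assumes "geodesic_line f"
  shows "f m \<in> side (f j) (f (j + 1)) \<longleftrightarrow> j < m"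
proof
  show "f m \<in> side (f j) (f (j + 1))" if "j < m"
  proof -
    let ?g = "\<lambda>i. f (j + int i)"
    have "?g (Suc (0 + nat (m - j - 1))) \<in> side (?g 0) (?g (Suc 0))"
    proof (intro nonbacktracking_side[of ?g])
      fix i
      show "adj (?g i) (?g (Suc i))"
        using assms[unfolded geodesic_line_def, rule_format, of "j + int i"]
        by (simp add: algebra_simps)
      show "?g i \<noteq> ?g (Suc (Suc i))"
        using assms[unfolded geodesic_line_def, rule_format, of "j + int i"]
        by (simp add: algebra_simps)
    qed
    then show ?thesis using that by simp
  qed
  have "f m \<in> side (f (j + 1)) (f j)" if "m \<le> j"
  proof -
    let ?g = "\<lambda>i. f (j + 1 - int i)"
    have "?g (Suc (0 + nat (j - m))) \<in> side (?g 0) (?g (Suc 0))"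
    proof (intro nonbacktracking_side[of ?g])
      fix i
      show "adj (?g i) (?g (Suc i))"
        using assms[unfolded geodesic_line_def, rule_format, of "j - int i"]
        by (simp add: adj_sym algebra_simps)
      show "?g i \<noteq> ?g (Suc (Suc i))"
        using assms[unfolded geodesic_line_def, rule_format, of "j - int i - 1"]
        by (auto simp: algebra_simps)
    qed
    then show ?thesis using that by simp
  qed
  then show "j < m" if "f m \<in> side (f j) (f (j + 1))"
    using that assms side_disjoint unfolding geodesic_line_def by (meson not_le)
qed

lemma geodesic_line_verts: "geodesic_line f \<Longrightarrow> f i \<in> V"
  using adjD by (auto simp: geodesic_line_def)

lemma geodesic_line_inj: "geodesic_line f \<Longrightarrow> inj f"
proof (rule injI)
  fix i j assume f: "geodesic_line f" "f i = f j"
  have "i < j \<longleftrightarrow> i < i" "j < i \<longleftrightarrow> j < j"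
    using f geodesic_line_side by metis+
  then show "i = j" by auto
qed

lemma geodesic_line_image:
  "automorphism \<alpha> \<Longrightarrow> geodesic_line f \<Longrightarrow> geodesic_line (\<lambda>i. \<alpha> (f i))"
  using automorphism_adj automorphism_eq geodesic_line_verts
  by (auto simp: geodesic_line_def)

lemma line_enters_side:
  assumes g: "geodesic_line g" and ab: "adj a b"
    and "g i \<notin> side a b" "g j \<in> side a b" "i \<le> j"
  shows "\<exists>m. g m = a \<and> g (m + 1) = b"
proof -
  have "\<exists>m<nat (j - i). g (i + int m) = a \<and> g (i + int (Suc m)) = b"
  proof (rule walk_crosses[OF ab, of _ "\<lambda>m. g (i + int m)"])
    show "adj (g (i + int m)) (g (i + int (Suc m)))" for m
      using g[unfolded geodesic_line_def, rule_format, of "i + int m"] by (simp add: algebra_simps)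
  qed (use assms in auto)
  then show ?thesis by (auto simp: algebra_simps)
qed

text \<open>
  The image of the axis \<open>f\<close> under \<open>\<beta>\<close> is a line \<open>g\<close> that \<open>\<alpha>\<close> also translates by \<open>k\<close>, and a
  translation has only one axis. Indeed only finitely many edges of \<open>f\<close> separate \<open>g 0\<close> from \<open>f 0\<close>.
  Translation by multiples of \<open>k\<close> turns this into the statement that, for every edge of \<open>f\<close>, the line
  \<open>g\<close> is behind the edge far in the past and beyond it far in the future. So \<open>g\<close> traverses all edges
  of \<open>f\<close> in their direction, and the two parametrizations differ by a shift.
\<close>

lemma commuting_translates_axis:
  assumes \<alpha>: "automorphism \<alpha>" and \<beta>: "automorphism \<beta>"
    and comm: "\<And>x. x \<in> V \<Longrightarrow> \<alpha> (\<beta> x) = \<beta> (\<alpha> x)"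
    and f: "geodesic_line f" and tr: "\<And>i. \<alpha> (f i) = f (i + k)" and k: "k \<noteq> 0"
  shows "\<exists>c. \<forall>i. \<beta> (f i) = f (i + c)"
proof -
  define g where "g i = \<beta> (f i)" for i
  have g: "geodesic_line g" using geodesic_line_image[OF \<beta> f] by (simp add: g_def[abs_def])
  have gtr: "\<alpha> (g i) = g (i + k)" for i
    using comm geodesic_line_verts[OF f] tr by (simp add: g_def)
  note fV = geodesic_line_verts[OF f] and gV = geodesic_line_verts[OF g]
  have fadj: "adj (f j) (f (j + 1))" for j using f by (simp add: geodesic_line_def)
  have shift1: "g (i + k) \<in> side (f (j + k)) (f (j + k + 1)) \<longleftrightarrow> g i \<in> side (f j) (f (j + 1))" for i j
    using side_image_iff[OF \<alpha> fadj gV, of i j] gtr tr by (simp add: algebra_simps)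
  have shift: "g (t * k) \<in> side (f (j + t * k)) (f (j + t * k + 1)) \<longleftrightarrow> g 0 \<in> side (f j) (f (j + 1))"
    for t j
  proof (induction t rule: int_induct[of _ 0])
    case base
    then show ?case by simp
  next
    case (step1 t)
    then show ?case using shift1[of "t * k" "j + t * k"] by (simp add: algebra_simps)
  next
    case (step2 t)
    then show ?case using shift1[of "(t - 1) * k" "j + (t - 1) * k"] by (simp add: algebra_simps)
  qed
  have "\<exists>M. \<forall>m. M < \<bar>m\<bar> \<longrightarrow> (g 0 \<in> side (f m) (f (m + 1)) \<longleftrightarrow> m < 0)"
  proof -
    let ?B = "{m. \<not> (g 0 \<in> side (f m) (f (m + 1)) \<longleftrightarrow> m < 0)}"
    have "(\<lambda>m. (f m, f (m + 1))) ` ?B \<subseteq> separating (f 0) (g 0) \<union> separating (g 0) (f 0)"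
      using geodesic_line_side[OF f] fadj by (auto simp: separating_def)
    moreover have "finite (separating (f 0) (g 0) \<union> separating (g 0) (f 0))"
      using finite_separating[OF fV gV] finite_separating[OF gV fV] by simp
    ultimately have "finite ((\<lambda>m. (f m, f (m + 1))) ` ?B)" by (rule finite_subset)
    then have "finite ?B"
      by (rule finite_imageD) (auto intro: inj_onI dest: injD[OF geodesic_line_inj[OF f]])
    then have "finite (abs ` ?B)" by simp
    then obtain M where "\<And>m. m \<in> abs ` ?B \<Longrightarrow> m \<le> M"
      by (metis bdd_above_finite bdd_above.E)
    then show ?thesis by (intro exI[of _ M]) force
  qed
  then obtain M where M: "\<And>m. M < \<bar>m\<bar> \<Longrightarrow> g 0 \<in> side (f m) (f (m + 1)) \<longleftrightarrow> m < 0" by blast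
  have "\<exists>i. g i = f j \<and> g (i + 1) = f (j + 1)" for j
  proof -
    \<comment> \<open>the factor \<open>k\<close> in \<open>t\<close> makes \<open>t * k\<close> large and positive for both signs of \<open>k\<close>\<close>
    define N where "N = \<bar>j\<bar> + \<bar>M\<bar> + 1"
    define t where "t = k * N"
    have "N \<le> t * k"
    proof -
      have "1 \<le> k * k" using k by (metis int_one_le_iff_zero_less not_real_square_gt_zero zero_less_mult_iff linorder_neqE_linordered_idom)
      then show ?thesis
        using mult_right_mono[of 1 "k * k" N] by (simp add: t_def N_def algebra_simps)
    qed
    then have big: "j - t * k < 0" "M < \<bar>j - t * k\<bar>" "0 \<le> j + t * k" "M < \<bar>j + t * k\<bar>"
      "- t * k \<le> t * k"
      by (auto simp: N_def)
    have "g (t * k) \<in> side (f j) (f (j + 1))"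
      using shift[of t "j - t * k"] M[of "j - t * k"] big by simp
    moreover have "g (- t * k) \<notin> side (f j) (f (j + 1))"
      using shift[of "- t" "j + t * k"] M[of "j + t * k"] big by simp
    ultimately show ?thesis using line_enters_side[OF g fadj] big(5) by blast
  qed
  then obtain h where h: "\<And>j. g (h j) = f j" "\<And>j. g (h j + 1) = f (j + 1)" by metis
  have hstep: "h (j + 1) = h j + 1" for j
    using injD[OF geodesic_line_inj[OF g]] h by metis
  have "h j = h 0 + j" for j
  proof (induction j rule: int_induct[of _ 0])
    case (step1 i)
    then show ?case using hstep[of i] by simp
  next
    case (step2 i)
    then show ?case using hstep[of "i - 1"] by simp
  qed simp
  then have "g (h 0 + j) = f j" for j using h(1) by metis
  then have "\<beta> (f i) = f (i + (- h 0))" for i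
    using g_def by (metis add.commute add_minus_cancel)
  then show ?thesis by blast
qed

lemma automorphism_funpow: "automorphism \<alpha> \<Longrightarrow> automorphism (\<alpha> ^^ n)"
proof (induction n)
  case 0
  then show ?case by (simp add: automorphism_def bij_betw_def)
next
  case (Suc n)
  then have IH: "automorphism (\<alpha> ^^ n)" by simp
  then have "bij_betw (\<alpha> \<circ> (\<alpha> ^^ n)) V V"
    using Suc.prems bij_betw_trans unfolding automorphism_def by blast
  moreover have "adj (\<alpha> ((\<alpha> ^^ n) x)) (\<alpha> ((\<alpha> ^^ n) y)) \<longleftrightarrow> adj x y" if "x \<in> V" "y \<in> V" for x y
    using that IH Suc.prems automorphism_verts[OF IH] by (simp add: automorphism_adj_iff)
  ultimately show ?case by (simp add: automorphism_def comp_def)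
qed

lemma automorphism_inv:
  assumes \<alpha>: "automorphism \<alpha>"
  shows "automorphism (inv_into V \<alpha>)"
proof -
  have b: "bij_betw \<alpha> V V" using \<alpha> by (simp add: automorphism_def)
  let ?\<beta> = "inv_into V \<alpha>"
  have \<beta>: "bij_betw ?\<beta> V V" using b by (rule bij_betw_inv_into)
  have "adj (?\<beta> x) (?\<beta> y) \<longleftrightarrow> adj x y" if "x \<in> V" "y \<in> V" for x y
    using that automorphism_adj_iff[OF \<alpha>, of "?\<beta> x" "?\<beta> y"] bij_betw_inv_into_right[OF b]
      bij_betwE[OF \<beta>] by simp
  then show ?thesis using \<beta> by (simp add: automorphism_def)
qed

text \<open>
  The two recursions together say that the powers commute with \<open>\<alpha>\<close>; they hold on the vertices only, as
  \<open>\<alpha>\<close> is arbitrary elsewhere.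
\<close>

lemma integer_powers:
  assumes \<alpha>: "automorphism \<alpha>"
  shows "\<exists>F :: int \<Rightarrow> 't \<Rightarrow> 't. (\<forall>q. automorphism (F q)) \<and> (\<forall>x\<in>V. F 0 x = x) \<and>
           (\<forall>q. \<forall>x\<in>V. F (q + 1) x = \<alpha> (F q x) \<and> F (q + 1) x = F q (\<alpha> x))"
proof (intro exI conjI allI ballI)
  let ?\<beta> = "inv_into V \<alpha>"
  let ?F = "\<lambda>q::int. if 0 \<le> q then \<alpha> ^^ nat q else ?\<beta> ^^ nat (- q)"
  have b: "bij_betw \<alpha> V V" using \<alpha> by (simp add: automorphism_def)
  have \<beta>: "automorphism ?\<beta>" using automorphism_inv[OF \<alpha>] .
  note cancel = bij_betw_inv_into_left[OF b] bij_betw_inv_into_right[OF b]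
  show "automorphism (?F q)" for q using automorphism_funpow \<alpha> \<beta> by simp
  show "?F 0 x = x" for x by simp
  fix q x assume x: "x \<in> V"
  show "?F (q + 1) x = \<alpha> (?F q x)" "?F (q + 1) x = ?F q (\<alpha> x)"
  proof (atomize (full), cases "0 \<le> q")
    case True
    then have "nat (q + 1) = Suc (nat q)" by simp
    then show "?F (q + 1) x = \<alpha> (?F q x) \<and> ?F (q + 1) x = ?F q (\<alpha> x)"
      using True by (simp add: funpow_swap1)
  next
    case False
    define m where "m = nat (- q - 1)"
    have m: "nat (- q) = Suc m" using False by (simp add: m_def)
    have F1: "?F (q + 1) = ?\<beta> ^^ m" using False by (auto simp: m_def)
    have mem: "(?\<beta> ^^ m) x \<in> V" using automorphism_verts[OF automorphism_funpow[OF \<beta>] x] .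
    have "(?\<beta> ^^ Suc m) (\<alpha> x) = (?\<beta> ^^ m) (?\<beta> (\<alpha> x))" by (simp add: funpow_swap1)
    then show "?F (q + 1) x = \<alpha> (?F q x) \<and> ?F (q + 1) x = ?F q (\<alpha> x)"
      unfolding F1 using False m cancel x mem by simp
  qed
qed

text \<open>
  Take a walk \<open>p\<close> of minimal length \<open>n\<close> from a vertex to its image and let \<open>f\<close> be the concatenation of
  the translates of \<open>p\<close> under the powers of \<open>\<alpha>\<close>. If \<open>f\<close> backtracked, then \<open>\<alpha>\<close> would invert an edge for
  \<open>n = 1\<close>, and for larger \<open>n\<close> the part of \<open>f\<close> from the turning point to its image, with the
  backtracking removed, would be a walk of length \<open>n - 2\<close> from a vertex to its image.
\<close>

lemma axis_exists:
  assumes \<alpha>: "automorphism \<alpha>" and nofix: "\<And>x. x \<in> V \<Longrightarrow> \<alpha> x \<noteq> x"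
    and noinv: "\<And>x. adj x (\<alpha> x) \<Longrightarrow> \<alpha> (\<alpha> x) \<noteq> x"
  shows "\<exists>f k. geodesic_line f \<and> k \<noteq> 0 \<and> (\<forall>i. \<alpha> (f i) = f (i + k))"
proof -
  let ?P = "\<lambda>n. \<exists>x\<in>V. (x, \<alpha> x) \<in> adjrel ^^ n"
  have "\<exists>n. ?P n"
  proof -
    obtain x where x: "x \<in> V" using verts_nonempty by blast
    then have "(x, \<alpha> x) \<in> adjrel\<^sup>*" using connected automorphism_verts[OF \<alpha>] by blast
    then show ?thesis using x rtrancl_power by blast
  qed
  then have ex: "?P (LEAST n. ?P n)" by (rule LeastI_ex)
  define n where "n = (LEAST n. ?P n)"
  have n: "?P n" unfolding n_def by (rule ex)
  have least: "n \<le> m" if "?P m" for m unfolding n_def using that by (rule Least_le)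
  obtain x p where x: "x \<in> V" and p: "p 0 = x" "p n = \<alpha> x"
    and step: "\<And>i. i < n \<Longrightarrow> adj (p i) (p (Suc i))"
    using n unfolding relpow_fun_conv by auto
  have "0 < n" using p nofix[OF x] by (cases n) auto
  have pV: "p r \<in> V" if "r \<le> n" for r
    using that x p(1) adjD[OF step[of "r - 1"]] by (cases r) auto
  obtain F :: "int \<Rightarrow> 't \<Rightarrow> 't" where F': "(\<forall>q. automorphism (F q)) \<and> (\<forall>x\<in>V. F 0 x = x) \<and>
      (\<forall>q. \<forall>x\<in>V. F (q + 1) x = \<alpha> (F q x) \<and> F (q + 1) x = F q (\<alpha> x))"
    using integer_powers[OF \<alpha>] by (rule exE)
  have F: "automorphism (F q)" "x \<in> V \<Longrightarrow> F (q + 1) x = \<alpha> (F q x)" "x \<in> V \<Longrightarrow> F (q + 1) x = F q (\<alpha> x)" for q x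
    using F' by blast+
  define f where "f i = F (i div int n) (p (nat (i mod int n)))" for i
  have f: "f (q * int n + int r) = F q (p r)" if "r \<le> n" for q r
  proof (cases "r = n")
    case True
    then have "q * int n + int r = (q + 1) * int n" by (simp add: algebra_simps)
    then have "f (q * int n + int r) = F (q + 1) (p 0)" using \<open>0 < n\<close> by (simp add: f_def)
    then show ?thesis using True p F(3)[OF x] by simp
  next
    case False
    then show ?thesis using that \<open>0 < n\<close> by (simp add: f_def)
  qed
  have decomp: "\<exists>q r. r < n \<and> i = q * int n + int r" for i
    using \<open>0 < n\<close> by (intro exI[of _ "i div int n"] exI[of _ "nat (i mod int n)"]) (simp add: nat_less_iff)
  have adj: "adj (f i) (f (i + 1))" for i
  proof -
    obtain q r where qr: "r < n" "i = q * int n + int r" using decomp by blast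
    then have "f i = F q (p r)" "f (i + 1) = F q (p (Suc r))"
      using f[of r q] f[of "Suc r" q] by (simp_all add: algebra_simps)
    then show ?thesis using automorphism_adj[OF F(1) step[OF qr(1)]] by simp
  qed
  have tr: "\<alpha> (f i) = f (i + int n)" for i
  proof -
    obtain q r where qr: "r < n" "i = q * int n + int r" using decomp by blast
    then have "i + int n = (q + 1) * int n + int r" by (simp add: algebra_simps)
    then have "f (i + int n) = F (q + 1) (p r)" using f[of r "q + 1"] qr(1) by simp
    moreover have "f i = F q (p r)" using f[of r q] qr by simp
    ultimately show ?thesis using F(2) pV qr(1) by simp
  qed
  have "f i \<noteq> f (i + 2)" for i
  proof
    assume eq: "f i = f (i + 2)"
    show False
    proof (cases "n = 1")
      case True
      then show False using noinv[of "f i"] tr[of i] tr[of "i + 1"] adj[of i] eq by (simp add: algebra_simps)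
    next
      case False
      then have "2 \<le> n" using \<open>0 < n\<close> by simp
      have "(f (i + 2), \<alpha> (f (i + 2))) \<in> adjrel ^^ (n - 2)"
        unfolding relpow_fun_conv
      proof (intro exI[of _ "\<lambda>m. f (i + 2 + int m)"] conjI allI impI)
        show "f (i + 2 + int (n - 2)) = \<alpha> (f (i + 2))"
          using tr[of i] eq \<open>2 \<le> n\<close> by (simp add: algebra_simps of_nat_diff)
        show "(f (i + 2 + int m), f (i + 2 + int (Suc m))) \<in> adjrel" for m
          using adj[of "i + 2 + int m"] by (simp add: algebra_simps)
      qed simp
      moreover have "f (i + 2) \<in> V" using adjD[OF adj] by blast
      ultimately have "n \<le> n - 2" using least by blast
      then show False using \<open>2 \<le> n\<close> by simp
    qed
  qed
  then have "geodesic_line f" using adj by (simp add: geodesic_line_def)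
  then show ?thesis using tr \<open>0 < n\<close> by (intro exI[of _ f] exI[of _ "int n"]) simp
qed

abbreviation adjrel_on :: "'t set \<Rightarrow> ('t \<times> 't) set" where
  "adjrel_on S \<equiv> {(u, w). u \<in> S \<and> w \<in> S \<and> adj u w}"

lemma adjrel_on_sym: "(x, y) \<in> (adjrel_on S)\<^sup>* \<Longrightarrow> (y, x) \<in> (adjrel_on S)\<^sup>*"
proof (rule symD[OF sym_rtrancl])
  show "sym (adjrel_on S)" unfolding sym_def using adj_sym by blast
qed

lemma is_line_if_geodesic_line_onto:
  assumes f: "geodesic_line f" and onto: "range f = V"
  shows "is_line T"
proof -
  have fadj: "adj (f i) (f (i + 1))" for i using f by (simp add: geodesic_line_def)
  have next_eq: "j = i + 1" if "adj (f i) (f j)" "i < j" for i j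
  proof -
    have "f i \<notin> side (f i) (f (i + 1))" "f j \<in> side (f i) (f (i + 1))"
      using geodesic_line_side[OF f] that(2) by auto
    then have "f j = f (i + 1)" using crossing_edge[OF that(1)] fadj by blast
    then show ?thesis using injD[OF geodesic_line_inj[OF f]] by blast
  qed
  have "edges T = {{f i, f (i + 1)} | i. True}"
  proof
    show "edges T \<subseteq> {{f i, f (i + 1)} | i. True}"
    proof
      fix e assume "e \<in> edges T"
      then obtain x y where e: "e = {x, y}" "adj x y" by (rule edge_cases)
      then obtain i j where ij: "x = f i" "y = f j" using adjD[OF e(2)] onto by (metis imageE)
      then have "i < j \<or> j < i" using adjD[OF e(2)] by (metis linorder_neqE)
      then show "e \<in> {{f i, f (i + 1)} | i. True}"
        using next_eq[of i j] next_eq[of j i] e ij by (auto simp: insert_commute)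
    qed
  qed (use fadj in auto)
  then show ?thesis
    using geodesic_line_inj[OF f] onto unfolding is_line_def bij_betw_def by blast
qed

end


section \<open>Splittings from inversions and translations\<close>

text \<open>
  The hypotheses on the group action, reduced to the generators: \<open>act v\<close> is the automorphism by which
  the vertex \<open>v\<close> of \<open>\<Gamma>\<close> acts. The action may invert edges, so a fixed point of the realization is a
  fixed vertex or the midpoint of a preserved edge. Minimality is stated for the vertex sets of
  invariant subtrees.
\<close>

locale commuting_family = tree T for T :: "'t ugraph" +
  fixes \<Gamma> :: "'a ugraph" and act :: "'a \<Rightarrow> 't \<Rightarrow> 't"
  assumes aut: "v \<in> verts \<Gamma> \<Longrightarrow> automorphism (act v)"
    and comm: "{u, v} \<in> edges \<Gamma> \<Longrightarrow> x \<in> V \<Longrightarrow> act u (act v x) = act v (act u x)"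
    and no_fixed_vertex: "x \<in> V \<Longrightarrow> \<exists>v\<in>verts \<Gamma>. act v x \<noteq> x"
    and no_fixed_edge: "e \<in> edges T \<Longrightarrow> \<exists>v\<in>verts \<Gamma>. act v ` e \<noteq> e"
    and minimal: "S \<subseteq> V \<Longrightarrow> S \<noteq> {} \<Longrightarrow>
      (\<And>x y. x \<in> S \<Longrightarrow> y \<in> S \<Longrightarrow> (x, y) \<in> (adjrel_on S)\<^sup>*) \<Longrightarrow>
      (\<And>v x. v \<in> verts \<Gamma> \<Longrightarrow> x \<in> V \<Longrightarrow> act v x \<in> S \<longleftrightarrow> x \<in> S) \<Longrightarrow> S = V"
begin

definition splits_at :: "'t set \<Rightarrow> bool" where
  "splits_at e \<longleftrightarrow> (\<exists>A B. A \<noteq> {} \<and> B \<noteq> {} \<and> A \<inter> B = {} \<and> A \<subseteq> verts \<Gamma> \<and> B \<subseteq> verts \<Gamma> \<and>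
     (\<forall>u\<in>A. \<forall>v\<in>B. {u, v} \<notin> edges \<Gamma>) \<and> (\<forall>w\<in>verts \<Gamma> - (A \<union> B). act w ` e = e))"

lemma splits_atI:
  assumes "A \<noteq> {}" "B \<noteq> {}" "A \<inter> B = {}" "A \<subseteq> verts \<Gamma>" "B \<subseteq> verts \<Gamma>"
    and "\<And>u v. u \<in> A \<Longrightarrow> v \<in> B \<Longrightarrow> {u, v} \<notin> edges \<Gamma>"
    and "\<And>w. w \<in> verts \<Gamma> - (A \<union> B) \<Longrightarrow> act w ` e = e"
  shows "splits_at e"
  unfolding splits_at_def
proof (rule exI[of _ A], rule exI[of _ B], intro conjI ballI)
  show "{u, v} \<notin> edges \<Gamma>" if "u \<in> A" "v \<in> B" for u v using that by (rule assms(6))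
  show "act w ` e = e" if "w \<in> verts \<Gamma> - (A \<union> B)" for w using that by (rule assms(7))
qed (rule assms)+

lemma splits_if_inversion:
  assumes v: "v \<in> verts \<Gamma>" and xy: "adj x y" "act v x = y" "act v y = x"
  shows "splits_at {x, y}"
proof -
  define B where "B = {u \<in> verts \<Gamma>. u \<noteq> v \<and> {v, u} \<notin> edges \<Gamma>}"
  have stab: "act w ` {x, y} = {x, y}" if "w \<in> verts \<Gamma> - ({v} \<union> B)" for w
    using that commuting_preserves_inverted_edge[OF aut[OF v] aut, of w x y] comm xy
    by (auto simp: B_def)
  have "act v ` {x, y} = {x, y}" using xy by auto
  then have "B \<noteq> {}" using stab no_fixed_edge[OF xy(1)] by auto
  then show ?thesis using v stab by (intro splits_atI[of "{v}" B]) (auto simp: B_def)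
qed

lemma splits_if_translation:
  assumes v: "v \<in> verts \<Gamma>" and f: "geodesic_line f" and k: "k \<noteq> 0"
    and tr: "\<And>i. act v (f i) = f (i + k)" and "\<not> is_line T"
  shows "splits_at {f 0, f 1}"
proof -
  define A where "A = {u \<in> verts \<Gamma>. \<exists>c. c \<noteq> 0 \<and> (\<forall>i. act u (f i) = f (i + c))}"
  define B where "B = {u \<in> verts \<Gamma>. \<nexists>c. \<forall>i. act u (f i) = f (i + c)}"
  have fixes_f: "act w (f i) = f i" if w: "w \<in> verts \<Gamma> - (A \<union> B)" for w i
  proof -
    obtain c where c: "\<forall>i. act w (f i) = f (i + c)" using w unfolding B_def by blast
    then have "c = 0" using w unfolding A_def by blast
    then show ?thesis using c by simp
  qed
  have "A \<noteq> {}" using v k tr unfolding A_def by blast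
  moreover have "B \<noteq> {}"
  proof
    assume "B = {}"
    then have trans: "\<exists>c. \<forall>i. act u (f i) = f (i + c)" if "u \<in> verts \<Gamma>" for u
      using that unfolding B_def by blast
    have "range f = V"
    proof (rule minimal)
      show "range f \<subseteq> V" using geodesic_line_verts[OF f] by blast
      show "(x, y) \<in> (adjrel_on (range f))\<^sup>*"
        if xy: "x \<in> range f" "y \<in> range f" for x y
      proof -
        let ?R = "adjrel_on (range f)"
        have from0: "(f 0, f i) \<in> ?R\<^sup>*" for i
        proof (induction i rule: int_induct[of _ 0])
          case (step1 i)
          have "(f i, f (i + 1)) \<in> ?R" using f by (auto simp: geodesic_line_def)
          with step1.IH show ?case by (rule rtrancl_into_rtrancl)
        next
          case (step2 i)
          have "adj (f (i - 1)) (f i)"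
            using f[unfolded geodesic_line_def, rule_format, of "i - 1"] by simp
          then have "(f i, f (i - 1)) \<in> ?R" using adj_sym[of "f i" "f (i - 1)"] by simp
          with step2.IH show ?case by (rule rtrancl_into_rtrancl)
        qed simp
        obtain i j where "x = f i" "y = f j" using xy by blast
        then show ?thesis
          using rtrancl_trans[OF adjrel_on_sym[OF from0[of i]] from0[of j]] by simp
      qed
      show "act u x \<in> range f \<longleftrightarrow> x \<in> range f" if u: "u \<in> verts \<Gamma>" and x: "x \<in> V" for u x
      proof -
        obtain c where c: "\<And>i. act u (f i) = f (i + c)" using trans[OF u] by blast
        show ?thesis
        proof
          assume "act u x \<in> range f"
          then obtain i where "act u x = f i" by blast
          then have "act u x = act u (f (i - c))" using c[of "i - c"] by simp
          then show "x \<in> range f"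
            using automorphism_eq[OF aut[OF u] x geodesic_line_verts[OF f]] by simp
        next
          assume "x \<in> range f"
          then show "act u x \<in> range f" using c by blast
        qed
      qed
    qed simp
    then show False using is_line_if_geodesic_line_onto[OF f] \<open>\<not> is_line T\<close> by blast
  qed
  moreover have "{a, b} \<notin> edges \<Gamma>" if ab: "a \<in> A" "b \<in> B" for a b
  proof
    assume e: "{a, b} \<in> edges \<Gamma>"
    obtain c where c: "c \<noteq> 0" "\<And>i. act a (f i) = f (i + c)" and a: "a \<in> verts \<Gamma>"
      using ab(1) unfolding A_def by blast
    have b: "b \<in> verts \<Gamma>" "\<nexists>d. \<forall>i. act b (f i) = f (i + d)"
      using ab(2) unfolding B_def by blast+
    then show False
      using commuting_translates_axis[OF aut[OF a] aut[OF b(1)] comm[OF e] f c(2) c(1)] by blast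
  qed
  moreover have "A \<inter> B = {}" "A \<subseteq> verts \<Gamma>" "B \<subseteq> verts \<Gamma>"
    unfolding A_def B_def by blast+
  moreover have "act w ` {f 0, f 1} = {f 0, f 1}" if "w \<in> verts \<Gamma> - (A \<union> B)" for w
    using fixes_f[OF that] by simp
  ultimately show ?thesis by (intro splits_atI[of A B]) blast+
qed

section \<open>Splittings from elliptic generators\<close>

text \<open>
  The map \<open>par\<close> moves every vertex one step towards a fixed end of the tree, and two vertices lie on
  the same horosphere iff some iterate \<open>par ^^ m\<close> agrees on them. A generator that fixes a vertex \<open>y\<close>
  preserves every horosphere, because it fixes all points \<open>(par ^^ n) y\<close> and any other vertex reaches one
  of these. Hence the horoball of all vertices at least as close to the end as \<open>par a\<close> is an invariant
  subtree, and it omits \<open>a\<close>.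
\<close>

lemma no_equivariant_parent_map:
  assumes ell: "\<And>v. v \<in> verts \<Gamma> \<Longrightarrow> \<exists>x\<in>V. act v x = x"
    and par: "\<And>x. x \<in> V \<Longrightarrow> adj x (par x)" and par2: "\<And>x. x \<in> V \<Longrightarrow> par (par x) \<noteq> x"
    and edge: "\<And>x y. adj x y \<Longrightarrow> y = par x \<or> x = par y"
    and equiv: "\<And>v x. v \<in> verts \<Gamma> \<Longrightarrow> x \<in> V \<Longrightarrow> par (act v x) = act v (par x)"
  shows False
proof -
  obtain a where a: "a \<in> V" using verts_nonempty by blast
  have parV: "(par ^^ n) x \<in> V" if "x \<in> V" for n x
    by (induction n) (use that par adjD in auto)
  have no_cycle: "(par ^^ n) x \<noteq> x" if "x \<in> V" "0 < n" for n x
  proof -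
    have "(par ^^ 0) x \<noteq> (par ^^ n) x"
    proof (rule nonbacktracking_inj[of "\<lambda>i. (par ^^ i) x"])
      show "adj ((par ^^ i) x) ((par ^^ Suc i) x)" for i
        using par[OF parV[OF that(1)]] by simp
      show "(par ^^ i) x \<noteq> (par ^^ Suc (Suc i)) x" for i
        using par2[OF parV[OF that(1), of i]] by simp
    qed (rule that(2))
    then show ?thesis by simp
  qed
  have meet: "\<exists>m n. (par ^^ m) x = (par ^^ n) y" if "x \<in> V" "y \<in> V" for x y
    using connected[OF that]
  proof (induction rule: rtrancl_induct)
    case (step y z)
    then obtain m n where mn: "(par ^^ m) x = (par ^^ n) y" by blast
    from edge[of y z] step(2) consider "z = par y" | "y = par z" by auto
    then show ?case
    proof cases
      case 1
      then have "(par ^^ Suc m) x = (par ^^ n) z" using mn by (simp add: funpow_swap1)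
      then show ?thesis by blast
    next
      case 2
      then have "(par ^^ m) x = (par ^^ Suc n) z" using mn by (simp add: funpow_swap1)
      then show ?thesis by blast
    qed
  qed blast
  have equiv_n: "(par ^^ n) (act v x) = act v ((par ^^ n) x)" if "v \<in> verts \<Gamma>" "x \<in> V" for v x n
    by (induction n) (use that equiv parV in auto)
  have level: "\<exists>m. (par ^^ m) (act v x) = (par ^^ m) x" if v: "v \<in> verts \<Gamma>" and x: "x \<in> V" for v x
  proof -
    obtain y where y: "y \<in> V" "act v y = y" using ell[OF v] by blast
    obtain m n where mn: "(par ^^ m) x = (par ^^ n) y" using meet[OF x y(1)] by blast
    have "(par ^^ m) (act v x) = act v ((par ^^ n) y)" using equiv_n[OF v x] mn by simp
    also have "\<dots> = (par ^^ n) y" using equiv_n[OF v y(1), of n] y(2) by simp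
    also have "\<dots> = (par ^^ m) x" using mn by simp
    finally show ?thesis by blast
  qed
  \<comment> \<open>the horoball at \<open>par a\<close>\<close>
  define S where "S = {x \<in> V. \<exists>n k. (par ^^ n) x = (par ^^ (n + k)) (par a)}"
  have up: "par x \<in> S" if x: "x \<in> S" for x
  proof -
    obtain n k where "x \<in> V" "(par ^^ n) x = (par ^^ (n + k)) (par a)" using x by (auto simp: S_def)
    moreover have "(par ^^ n) (par x) = par ((par ^^ n) x)" by (simp add: funpow_swap1)
    ultimately have "par x \<in> V \<and> (par ^^ n) (par x) = (par ^^ (n + Suc k)) (par a)"
      using parV[of x 1] by simp
    then show ?thesis unfolding S_def by blast
  qed
  have "S = V"
  proof (rule minimal)
    show SV: "S \<subseteq> V" unfolding S_def by blast
    have "par a \<in> S"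
      unfolding S_def using parV[OF a, of 1] by (intro CollectI conjI exI[of _ "0::nat"]) simp_all
    then show "S \<noteq> {}" by blast
    fix x y assume xy: "x \<in> S" "y \<in> S"
    let ?R = "adjrel_on S"
    have ray: "z \<in> S \<Longrightarrow> (par ^^ n) z \<in> S \<and> (z, (par ^^ n) z) \<in> ?R\<^sup>*" for z n
    proof (induction n)
      case (Suc n)
      then have "((par ^^ n) z, (par ^^ Suc n) z) \<in> ?R"
        using up[of "(par ^^ n) z"] par[of "(par ^^ n) z"] SV by auto
      then show ?case using Suc rtrancl_into_rtrancl[of z "(par ^^ n) z" ?R] by simp
    qed simp
    obtain m n where mn: "(par ^^ m) x = (par ^^ n) y" using meet[of x y] xy SV by blast
    have "(x, (par ^^ m) x) \<in> ?R\<^sup>*" "((par ^^ m) x, y) \<in> ?R\<^sup>*"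
      using ray[OF xy(1), of m] adjrel_on_sym ray[OF xy(2), of n] mn by auto
    then show "(x, y) \<in> ?R\<^sup>*" by (rule rtrancl_trans)
  next
    fix v x assume v: "v \<in> verts \<Gamma>" and x: "x \<in> V"
    have transfer: "z \<in> S" if z: "z \<in> V" and w: "w \<in> S" and eq: "(par ^^ m) z = (par ^^ m) w" for z w m
    proof -
      obtain n k where "(par ^^ n) w = (par ^^ (n + k)) (par a)" using w unfolding S_def by blast
      moreover have "(par ^^ (n + m)) z = (par ^^ m) ((par ^^ n) w)"
      proof -
        have "(par ^^ (n + m)) z = (par ^^ n) ((par ^^ m) w)" using eq by (simp add: funpow_add)
        also have "\<dots> = (par ^^ (m + n)) w"
          using funpow_add[of n m par, THEN fun_cong, of w] by (simp add: add.commute)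
        finally show ?thesis by (simp add: funpow_add)
      qed
      moreover have "(par ^^ m) ((par ^^ (n + k)) (par a)) = (par ^^ (n + m + k)) (par a)"
        using funpow_add[of m "n + k" par, THEN fun_cong, of "par a"] by (simp add: add_ac)
      ultimately have "(par ^^ (n + m)) z = (par ^^ (n + m + k)) (par a)" by simp
      then show ?thesis using z unfolding S_def by blast
    qed
    obtain m where m: "(par ^^ m) (act v x) = (par ^^ m) x" using level[OF v x] by blast
    show "act v x \<in> S \<longleftrightarrow> x \<in> S"
      using transfer[OF x _ m[symmetric]] transfer[OF automorphism_verts[OF aut[OF v] x] _ m] by blast
  qed
  \<comment> \<open>so \<open>a\<close> would be at least as close to the end as \<open>par a\<close>, and \<open>par\<close> would have a cycle\<close>
  then obtain n k where "(par ^^ n) a = (par ^^ (n + k)) (par a)" using a unfolding S_def by blast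
  also have "\<dots> = (par ^^ (Suc k + n)) a"
    using funpow_swap1[of par "n + k" a] by (simp add: add.commute)
  finally have "(par ^^ n) a = (par ^^ (Suc k + n)) a" .
  then have "(par ^^ Suc k) ((par ^^ n) a) = (par ^^ n) a" by (simp only: funpow_add comp_apply)
  then show False using no_cycle[OF parV[OF a], of "Suc k" n] by simp
qed

text \<open>
  Every generator in \<open>pulls a b\<close> has all its fixed vertices beyond the edge from \<open>a\<close> to \<open>b\<close>. One such
  vertex suffices in the definition: by \<open>fixes_separating_edge\<close> a generator with fixed vertices on both
  sides would fix the edge.
\<close>

definition pulls :: "'t \<Rightarrow> 't \<Rightarrow> 'a set" where
  "pulls a b = {v \<in> verts \<Gamma>. \<not> (act v a = a \<and> act v b = b) \<and>
     (\<exists>y\<in>V. act v y = y \<and> y \<in> side a b)}"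

text \<open>
  Let \<open>u\<close> and \<open>v\<close> commute and let \<open>u\<close> fix \<open>x\<close> beyond the edge, \<open>v\<close> fix \<open>y\<close> before it. Then \<open>u\<close> also fixes
  \<open>act v x\<close>, which therefore lies beyond the edge like \<open>x\<close>, and so \<open>v\<close> fixes the edge by
  \<open>fixes_separating_edge\<close>. Hence no generator in \<open>pulls a b\<close> is adjacent to one in \<open>pulls b a\<close>.
\<close>

lemma splits_if_pulled_both_ways:
  assumes ab: "adj a b" and ne: "pulls a b \<noteq> {}" "pulls b a \<noteq> {}"
    and ell: "\<And>v. v \<in> verts \<Gamma> \<Longrightarrow> \<exists>x\<in>V. act v x = x"
  shows "splits_at {a, b}"
proof -
  have sep: "act v a = a \<and> act v b = b"
    if "v \<in> verts \<Gamma>" "y \<in> V" "act v y = y" "y \<in> side b a"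
      "x \<in> V" "x \<in> side a b" "act v x \<in> side a b" for v x y
    using that fixes_separating_edge[OF aut ab, of v y x] side_swap[OF ab] by blast
  have "pulls a b \<inter> pulls b a = {}"
  proof -
    have False if "v \<in> pulls a b" "v \<in> pulls b a" for v
      using that sep[of v] unfolding pulls_def by (smt (verit, ccfv_SIG) mem_Collect_eq)
    then show ?thesis by blast
  qed
  moreover have "{u, v} \<notin> edges \<Gamma>" if u: "u \<in> pulls a b" and v: "v \<in> pulls b a" for u v
  proof
    assume e: "{u, v} \<in> edges \<Gamma>"
    obtain x where x: "x \<in> V" "act u x = x" "x \<in> side a b" and uG: "u \<in> verts \<Gamma>"
      using u by (auto simp: pulls_def)
    obtain y where y: "y \<in> V" "act v y = y" "y \<in> side b a" and vG: "v \<in> verts \<Gamma>"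
      using v by (auto simp: pulls_def)
    have vx: "act u (act v x) = act v x" "act v x \<in> V"
      using comm[OF e x(1)] x automorphism_verts[OF aut[OF vG]] by auto
    have "act v x \<in> side a b"
    proof (rule ccontr)
      assume "act v x \<notin> side a b"
      then show False
        using sep[OF uG vx(2,1)] x side_swap[OF ab vx(2)] u by (auto simp: pulls_def)
    qed
    then show False using sep[OF vG y x(1,3)] v by (auto simp: pulls_def)
  qed
  moreover have "act w ` {a, b} = {a, b}" if "w \<in> verts \<Gamma> - (pulls a b \<union> pulls b a)" for w
    using that ell[of w] side_cover[OF ab] by (auto simp: pulls_def)
  moreover have "pulls a b \<subseteq> verts \<Gamma>" "pulls b a \<subseteq> verts \<Gamma>" by (auto simp: pulls_def)
  ultimately show ?thesis using ne by (intro splits_atI[of "pulls a b" "pulls b a"]) blast+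
qed

text \<open>
  If no edge is pulled both ways, then every vertex has at most one neighbour towards which it is
  pulled, since a generator that pulls \<open>a\<close> towards \<open>b\<close> pulls \<open>c\<close> towards \<open>a\<close> for every other neighbour
  \<open>c\<close> of \<open>a\<close>. It has at least one, as some generator moves it. The resulting map commutes with every
  generator \<open>v\<close>: at the vertices that \<open>v\<close> moves it points towards the fixed vertices of \<open>v\<close>, and at
  those that \<open>v\<close> fixes \<open>v\<close> must also fix the next vertex, for otherwise \<open>v\<close> would pull against the
  arrow.
\<close>

lemma splits_if_elliptic:
  assumes ell: "\<And>v. v \<in> verts \<Gamma> \<Longrightarrow> \<exists>x\<in>V. act v x = x"
  shows "\<exists>e\<in>edges T. splits_at e"
proof (rule ccontr)
  assume "\<not> (\<exists>e\<in>edges T. splits_at e)"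
  then have no_split: "\<not> splits_at e" if "e \<in> edges T" for e using that by blast
  have one_way: "pulls a b = {} \<or> pulls b a = {}" if ab: "adj a b" for a b
    using splits_if_pulled_both_ways[OF ab _ _ ell] no_split[OF ab] by auto
  have pulled: "v \<in> pulls a b \<or> v \<in> pulls b a"
    if "v \<in> verts \<Gamma>" "adj a b" "\<not> (act v a = a \<and> act v b = b)" for v a b
    using that ell[of v] side_cover[OF that(2)] by (auto simp: pulls_def)
  have unique: "b = c" if ab: "adj a b" and ac: "adj a c" and ne: "pulls a b \<noteq> {}" "pulls a c \<noteq> {}" for a b c
  proof (rule ccontr)
    assume "b \<noteq> c"
    obtain v y where v: "v \<in> verts \<Gamma>" "\<not> (act v a = a \<and> act v b = b)"
      and y: "y \<in> V" "act v y = y" "y \<in> side a b"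
      using ne(1) by (auto simp: pulls_def)
    have "act v a \<noteq> a"
    proof
      assume "act v a = a"
      then show False
        using fixes_separating_edge[OF aut[OF v(1)] ab, of a y] v y adjD[OF ab]
          start_notin_side[OF ab] by auto
    qed
    moreover have "y \<in> side c a" using side_subset[OF ab ac \<open>b \<noteq> c\<close>] y by blast
    ultimately have "v \<in> pulls c a" using v y by (auto simp: pulls_def)
    then show False using one_way[OF ac] ne(2) by blast
  qed
  have toward: "\<exists>b. adj a b \<and> v \<in> pulls a b"
    if v: "v \<in> verts \<Gamma>" and a: "a \<in> V" "act v a \<noteq> a" for v a
  proof -
    obtain y where y: "y \<in> V" "act v y = y" using ell[OF v] by blast
    then obtain b where "adj a b" "y \<in> side a b" using first_step[OF a(1) y(1)] a(2) by auto
    then show ?thesis using v a y by (auto simp: pulls_def)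
  qed
  define par where "par a = (SOME b. adj a b \<and> pulls a b \<noteq> {})" for a
  have "\<exists>b. adj a b \<and> pulls a b \<noteq> {}" if "a \<in> V" for a
    using no_fixed_vertex[OF that] toward that by blast
  then have par: "adj a (par a) \<and> pulls a (par a) \<noteq> {}" if "a \<in> V" for a
    unfolding par_def using that by (metis (mono_tags, lifting) someI_ex)
  have par_eq: "par a = b" if "adj a b" "pulls a b \<noteq> {}" for a b
    using unique[OF _ that(1) _ that(2)] par adjD[OF that(1)] by blast
  have "par (act v x) = act v (par x)" if v: "v \<in> verts \<Gamma>" and x: "x \<in> V" for v x
  proof (cases "act v x = x")
    case True
    have adj: "adj x (par x)" using par[OF x] by simp
    have "pulls (par x) x = {}" using one_way[OF adj] par[OF x] by blast
    moreover have "x \<in> side (par x) x" by (rule side_self)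
    ultimately have "act v (par x) = par x" using True v x by (auto simp: pulls_def)
    then show ?thesis using True by simp
  next
    case False
    then obtain b where b: "adj x b" "v \<in> pulls x b" using toward[OF v x] by blast
    then have "par x = b" using par_eq by blast
    obtain y where y: "y \<in> V" "act v y = y" "y \<in> side x b" using b by (auto simp: pulls_def)
    have "y \<in> side (act v x) (act v b)" using side_image[OF aut[OF v] b(1) y(3)] y by simp
    moreover have "act v (act v x) \<noteq> act v x"
      using False automorphism_eq[OF aut[OF v]] x automorphism_verts[OF aut[OF v] x] by simp
    ultimately have "v \<in> pulls (act v x) (act v b)" using v y by (auto simp: pulls_def)
    then show ?thesis
      using par_eq[OF automorphism_adj[OF aut[OF v] b(1)]] \<open>par x = b\<close> by blast
  qed
  moreover have "par (par x) \<noteq> x" if "x \<in> V" for x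
    using par[OF that] par[of "par x"] one_way[of x "par x"] adjD by metis
  moreover have "y = par x \<or> x = par y" if xy: "adj x y" for x y
  proof -
    obtain v where "v \<in> verts \<Gamma>" "act v x \<noteq> x" using no_fixed_vertex adjD[OF xy] by blast
    then have "pulls x y \<noteq> {} \<or> pulls y x \<noteq> {}" using pulled[OF _ xy] by blast
    then show ?thesis using par_eq[OF xy] par_eq[of y x] xy adj_sym by blast
  qed
  ultimately show False using no_equivariant_parent_map[OF ell] par by blast
qed

theorem splits_at_some_edge:
  assumes "\<not> is_line T"
  shows "\<exists>e\<in>edges T. splits_at e"
proof (cases "\<forall>v\<in>verts \<Gamma>. \<exists>x\<in>V. act v x = x")
  case True
  then show ?thesis using splits_if_elliptic by blast
next
  case False
  then obtain v where v: "v \<in> verts \<Gamma>" "\<And>x. x \<in> V \<Longrightarrow> act v x \<noteq> x" by blast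
  show ?thesis
  proof (cases "\<exists>x. adj x (act v x) \<and> act v (act v x) = x")
    case True
    then show ?thesis using splits_if_inversion[OF v(1)] by blast
  next
    case False
    then obtain f k where f: "geodesic_line f" "k \<noteq> 0" "\<And>i. act v (f i) = f (i + k)"
      using axis_exists[OF aut[OF v(1)] v(2)] by blast
    have "adj (f 0) (f 1)" using f(1)[unfolded geodesic_line_def, rule_format, of 0] by simp
    then show ?thesis using splits_if_translation[OF v(1) f assms] by blast
  qed
qed

end


section \<open>Right-angled Artin groups\<close>

lemma presented_group_inverse_letter:
  assumes "x \<in> X"
  shows "pres_rel X R `` {[(x, False)]} =
           inv\<^bsub>presented_group X R\<^esub> (pres_rel X R `` {[(x, True)]})"
proof -
  let ?G = "presented_group X R"
  interpret group ?G by (rule group_presented_group)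
  have cl: "pres_rel X R `` {w} \<in> carrier ?G" if "w \<in> words X" for w
    using that by (simp add: presented_group_def quotientI)
  have "([(x, False), (x, True)], []) \<in> pres_rel X R"
    using word_inv_left[of "[(x, True)]" X R] assms by (simp add: word_inv_def)
  then have "pres_rel X R `` {[(x, False)] @ [(x, True)]} = pres_rel X R `` {[]}"
    using equiv_class_eq[OF equiv_pres_rel] by fastforce
  then have "pres_rel X R `` {[(x, False)]} \<otimes>\<^bsub>?G\<^esub> pres_rel X R `` {[(x, True)]} = \<one>\<^bsub>?G\<^esub>"
    using assms by (subst presented_mult) (simp_all add: presented_group_def)
  then show ?thesis using assms by (intro inv_equality[symmetric] cl) simp_all
qed

text \<open>
  Letters of exponent \<open>False\<close> are inverses of generators, so the class of a word is a product of
  generators and their inverses.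
\<close>

lemma presented_group_generated:
  "carrier (presented_group X R) =
     generate (presented_group X R) ((\<lambda>x. pres_rel X R `` {[(x, True)]}) ` X)"
    (is "_ = generate ?G ?gens")
proof
  interpret group ?G by (rule group_presented_group)
  have "?gens \<subseteq> carrier ?G" by (auto simp: presented_group_def intro!: quotientI)
  then show "generate ?G ?gens \<subseteq> carrier ?G" by (rule generate_incl)
  have "pres_rel X R `` {w} \<in> generate ?G ?gens" if "w \<in> words X" for w
    using that
  proof (induction w)
    case Nil
    show ?case using generate.one[of ?G ?gens] by (simp add: presented_group_def)
  next
    case (Cons l w)
    obtain x b where l: "l = (x, b)" by (cases l)
    have x: "x \<in> X" and w: "w \<in> words X" using Cons.prems l by auto
    have "pres_rel X R `` {[(x, b)]} \<in> generate ?G ?gens"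
      using x generate.incl[of _ ?gens ?G] generate.inv[of _ ?gens ?G]
      by (cases b) (auto simp: presented_group_inverse_letter)
    moreover have "pres_rel X R `` {l # w} =
        pres_rel X R `` {[(x, b)]} \<otimes>\<^bsub>?G\<^esub> pres_rel X R `` {w}"
      using x w l by (subst presented_mult) simp_all
    ultimately show ?case using Cons.IH[OF w] generate.eng by simp
  qed
  then show "carrier ?G \<subseteq> generate ?G ?gens"
    by (auto simp: presented_group_def elim!: quotientE)
qed

lemma raag_generated: "carrier (raag \<Gamma>) = generate (raag \<Gamma>) (raag_gen \<Gamma> ` verts \<Gamma>)"
  using presented_group_generated[of "verts \<Gamma>" "raag_relators \<Gamma>"]
  by (simp add: raag_def raag_gen_def[abs_def])

lemma raag_gen_closed: "v \<in> verts \<Gamma> \<Longrightarrow> raag_gen \<Gamma> v \<in> carrier (raag \<Gamma>)"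
  by (simp add: raag_def raag_gen_def presented_group_def quotientI)

lemma raag_gens_commute:
  assumes "simple_graph \<Gamma>" and e: "{u, v} \<in> edges \<Gamma>"
  shows "raag_gen \<Gamma> u \<otimes>\<^bsub>raag \<Gamma>\<^esub> raag_gen \<Gamma> v = raag_gen \<Gamma> v \<otimes>\<^bsub>raag \<Gamma>\<^esub> raag_gen \<Gamma> u"
proof -
  let ?X = "verts \<Gamma>" and ?R = "raag_relators \<Gamma>"
  have uv: "u \<in> ?X" "v \<in> ?X"
    using assms unfolding simple_graph_def by (metis doubleton_eq_iff)+
  let ?w = "[(u, True), (v, True), (u, False), (v, False), (v, True), (u, True)]"
  \<comment> \<open>the word \<open>u v u\<inverse> v\<inverse> v u\<close> reduces to \<open>u v\<close> by cancellation and to \<open>v u\<close> by the relator\<close>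
  have "pres_step ?X ?R ?w [(u, True), (v, True), (u, False), (u, True)]"
    using pres_step.cancel[of "[(u, True), (v, True), (u, False)]" ?X "[(u, True)]" v ?R False] uv
    by simp
  moreover have "pres_step ?X ?R [(u, True), (v, True), (u, False), (u, True)] [(u, True), (v, True)]"
    using pres_step.cancel[of "[(u, True), (v, True)]" ?X "[]" u ?R False] uv by simp
  moreover have "pres_step ?X ?R ?w [(v, True), (u, True)]"
    using pres_step.relator[of "[]" ?X "[(v, True), (u, True)]" "commutator_word u v" ?R] uv e
    by (auto simp: commutator_word_def raag_relators_def)
  ultimately have "equivclp (pres_step ?X ?R) [(u, True), (v, True)] [(v, True), (u, True)]"
    by (meson r_into_equivclp equivclp_sym equivclp_trans)
  then have "([(u, True), (v, True)], [(v, True), (u, True)]) \<in> pres_rel ?X ?R"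
    using uv by (simp add: pres_rel_def)
  then have "pres_rel ?X ?R `` {[(u, True), (v, True)]} = pres_rel ?X ?R `` {[(v, True), (u, True)]}"
    by (rule equiv_class_eq[OF equiv_pres_rel])
  then show ?thesis
    using uv by (simp add: raag_def raag_gen_def presented_mult)
qed

lemma generate_preserves_set:
  assumes act: "group_action G E \<phi>" and S: "S \<subseteq> E"
    and X: "X \<subseteq> carrier G" "\<And>g. g \<in> X \<Longrightarrow> \<phi> g ` S = S" and h: "h \<in> generate G X"
  shows "\<phi> h ` S = S"
proof -
  interpret group_action G E \<phi> by (rule act)
  have grp: "group G" using group_hom group_hom.axioms(1) by blast
  show ?thesis using h
  proof (induction rule: generate.induct)
    case one
    have "\<phi> \<one>\<^bsub>G\<^esub> x = x" if "x \<in> S" for x using id_eq_one S that by (metis restrict_apply' subsetD)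
    then show ?case by simp
  next
    case (incl g)
    then show ?case by (rule X(2))
  next
    case (inv g)
    have g: "g \<in> carrier G" using inv X(1) by blast
    have cancel: "\<phi> (inv\<^bsub>G\<^esub> g) (\<phi> g x) = x" if "x \<in> S" for x
      using orbit_sym_aux[OF g, of x] S that by blast
    have "\<phi> (inv\<^bsub>G\<^esub> g) ` (\<phi> g ` S) = S" using cancel by force
    then show ?case using X(2)[OF inv] by simp
  next
    case (eng g h)
    have gh: "g \<in> carrier G" "h \<in> carrier G"
      using eng group.generate_in_carrier[OF grp X(1)] by auto
    have "\<phi> (g \<otimes>\<^bsub>G\<^esub> h) ` S = \<phi> g ` (\<phi> h ` S)"
      unfolding image_image using composition_rule[OF _ gh] S by (intro image_cong) auto
    then show ?case using eng by simp
  qed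
qed

lemma disconnected_graph_if_no_edge_between:
  assumes H: "verts H = A \<union> B" "simple_graph H" and ne: "A \<noteq> {}" "B \<noteq> {}" "A \<inter> B = {}"
    and no_edge: "\<And>u v. u \<in> A \<Longrightarrow> v \<in> B \<Longrightarrow> {u, v} \<notin> edges H"
  shows "disconnected_graph H"
proof -
  obtain a b where ab: "a \<in> A" "b \<in> B" using ne by blast
  have stay: "x \<in> A" if "(a, x) \<in> {(x, y). {x, y} \<in> edges H}\<^sup>*" for x
    using that
  proof (induction rule: rtrancl_induct)
    case base
    show ?case by (rule ab)
  next
    case (step y z)
    then have yz: "{y, z} \<in> edges H" by simp
    then have "z \<in> A \<union> B" using H unfolding simple_graph_def by (metis doubleton_eq_iff)
    then show ?case using no_edge[of y z] step yz by blast
  qed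
  have "walk_rel H `` {a} \<noteq> walk_rel H `` {b}"
  proof
    assume eq: "walk_rel H `` {a} = walk_rel H `` {b}"
    have "b \<in> walk_rel H `` {b}" using ab H by (simp add: walk_rel_def)
    then have "(a, b) \<in> {(x, y). {x, y} \<in> edges H}\<^sup>*"
      unfolding eq[symmetric] by (simp add: walk_rel_def)
    then show False using stay ab ne by blast
  qed
  moreover have "walk_rel H `` {a} \<in> components H" "walk_rel H `` {b} \<in> components H"
    unfolding components_def using ab H by (auto intro!: quotientI)
  ultimately show ?thesis unfolding disconnected_graph_def by blast
qed

lemma simple_graph_induced_on: "simple_graph G \<Longrightarrow> simple_graph (induced_on G S)"
  unfolding simple_graph_def induced_on_def by fastforce

lemma (in tree) induced_subtree:
  assumes S: "S \<subseteq> V" "S \<noteq> {}"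
    and conn: "\<And>x y. x \<in> S \<Longrightarrow> y \<in> S \<Longrightarrow> (x, y) \<in> (adjrel_on S)\<^sup>*"
  shows "is_subgraph (induced_on T S) T" "is_tree (induced_on T S)"
proof -
  have simple: "simple_graph (induced_on T S)"
    using tree simple_graph_induced_on unfolding is_tree_def by blast
  then show "is_subgraph (induced_on T S) T"
    using S by (auto simp: is_subgraph_def induced_on_def)
  have R: "{(x, y). {x, y} \<in> edges (induced_on T S)} = adjrel_on S"
    by (auto simp: induced_on_def)
  have "walk_rel (induced_on T S) `` {x} = S" if "x \<in> S" for x
    using conn that unfolding walk_rel_def R by (auto simp: induced_on_def)
  then have "components (induced_on T S) = {S}"
    using S(2) by (auto simp: components_def quotient_def induced_on_def)
  moreover have "\<not> is_cycle (induced_on T S) c" for c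
  proof
    assume "is_cycle (induced_on T S) c"
    then have "is_cycle T c" by (simp add: is_cycle_def induced_on_def)
    then show False using tree unfolding is_tree_def by blast
  qed
  ultimately show "is_tree (induced_on T S)"
    using simple unfolding is_tree_def connected_graph_def by blast
qed

text \<open>
  Since the generators generate the group, a set of vertices of \<open>T\<close> that all generators preserve is
  preserved by the group. Applied to \<open>{x}\<close>, to an edge, and to the vertex set of a subtree, this carries
  nontriviality and minimality over from the group to the generators.
\<close>

lemma raag_commuting_family:
  assumes graph: "simple_graph \<Gamma>" and action: "tree_action (raag \<Gamma>) T \<phi>"
    and nontriv: "nontrivial_action (raag \<Gamma>) T \<phi>" and min: "minimal_action (raag \<Gamma>) T \<phi>"
  shows "commuting_family T \<Gamma> (\<lambda>v. \<phi> (raag_gen \<Gamma> v))"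
proof -
  interpret tree T using action by unfold_locales (simp add: tree_action_def)
  have act: "group_action (raag \<Gamma>) V \<phi>" using action by (simp add: tree_action_def)
  interpret group_action "raag \<Gamma>" V \<phi> by (rule act)
  have adj: "adj (\<phi> g x) (\<phi> g y) \<longleftrightarrow> adj x y"
    if "g \<in> carrier (raag \<Gamma>)" "x \<in> V" "y \<in> V" for g x y
    using that action unfolding tree_action_def by blast
  have bij: "bij_betw (\<phi> g) V V" if "g \<in> carrier (raag \<Gamma>)" for g
    using that inj_prop surj_prop by (simp add: bij_betw_def)
  have gens: "raag_gen \<Gamma> ` verts \<Gamma> \<subseteq> carrier (raag \<Gamma>)" using raag_gen_closed[of _ \<Gamma>] by blast
  have preserved: "\<phi> g ` S = S"
    if "S \<subseteq> V" "\<And>v. v \<in> verts \<Gamma> \<Longrightarrow> \<phi> (raag_gen \<Gamma> v) ` S = S" "g \<in> carrier (raag \<Gamma>)" for S g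
    using generate_preserves_set[OF act that(1) gens _ that(3)[unfolded raag_generated]] that(2)
    by blast
  have mem_iff: "\<phi> g x \<in> S \<longleftrightarrow> x \<in> S"
    if pres: "\<phi> g ` S = S" and S: "S \<subseteq> V" and g: "g \<in> carrier (raag \<Gamma>)" and x: "x \<in> V" for g S x
  proof
    assume "\<phi> g x \<in> S"
    then obtain y where y: "y \<in> S" "\<phi> g x = \<phi> g y" using pres by blast
    then have "x = y" using inj_onD[OF inj_prop[OF g], of x y] x S by blast
    then show "x \<in> S" using y by simp
  next
    assume "x \<in> S"
    then show "\<phi> g x \<in> S" using pres by blast
  qed
  have no_fixed_point: False
    if S: "S \<subseteq> V" and pres: "\<And>v. v \<in> verts \<Gamma> \<Longrightarrow> \<phi> (raag_gen \<Gamma> v) ` S = S"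
      and S': "(\<exists>x\<in>V. S = {x}) \<or> S \<in> edges T" for S
  proof -
    \<comment> \<open>the barycentre of \<open>S\<close>: a vertex, or the midpoint of an edge\<close>
    define p where "p x = (if x \<in> S then 1 / real (card S) else 0)" for x
    have fin: "finite S" "S \<noteq> {}" using S' edge_finite[of S] by auto
    have supp: "{x. p x \<noteq> 0} = S" using fin by (auto simp: p_def)
    have "sum p S = 1" using fin by (simp add: p_def)
    then have "p \<in> realization T"
      unfolding realization_def using S' by (auto simp: supp) (auto simp: p_def)
    moreover have "p (\<phi> g x) = p x" if "g \<in> carrier (raag \<Gamma>)" "x \<in> V" for g x
      using mem_iff[OF preserved[OF S pres that(1)] S that] by (simp add: p_def)
    ultimately show False using nontriv unfolding nontrivial_action_def by blast
  qed
  show ?thesis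
  proof unfold_locales
    show "automorphism (\<phi> (raag_gen \<Gamma> v))" if "v \<in> verts \<Gamma>" for v
      using bij adj raag_gen_closed[OF that] by (simp add: automorphism_def)
    show "\<phi> (raag_gen \<Gamma> u) (\<phi> (raag_gen \<Gamma> v) x) = \<phi> (raag_gen \<Gamma> v) (\<phi> (raag_gen \<Gamma> u) x)"
      if e: "{u, v} \<in> edges \<Gamma>" and x: "x \<in> V" for u v x
    proof -
      have uv: "u \<in> verts \<Gamma>" "v \<in> verts \<Gamma>"
        using graph e unfolding simple_graph_def by (metis doubleton_eq_iff)+
      show ?thesis
        using raag_gens_commute[OF graph e] composition_rule[OF x] raag_gen_closed[of _ \<Gamma>] uv by metis
    qed
    show "\<exists>v\<in>verts \<Gamma>. \<phi> (raag_gen \<Gamma> v) x \<noteq> x" if "x \<in> V" for x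
      using no_fixed_point[of "{x}"] that by auto
    show "\<exists>v\<in>verts \<Gamma>. \<phi> (raag_gen \<Gamma> v) ` e \<noteq> e" if "e \<in> edges T" for e
    proof -
      have "e \<subseteq> V" using edge_finite that by blast
      then show ?thesis using no_fixed_point[of e] that by blast
    qed
  next
    fix S
    assume S: "S \<subseteq> V" "S \<noteq> {}"
      and conn: "\<And>x y. x \<in> S \<Longrightarrow> y \<in> S \<Longrightarrow> (x, y) \<in> (adjrel_on S)\<^sup>*"
      and inv: "\<And>v x. v \<in> verts \<Gamma> \<Longrightarrow> x \<in> V \<Longrightarrow> \<phi> (raag_gen \<Gamma> v) x \<in> S \<longleftrightarrow> x \<in> S"
    have "\<phi> (raag_gen \<Gamma> v) ` S = S" if v: "v \<in> verts \<Gamma>" for v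
    proof
      show "\<phi> (raag_gen \<Gamma> v) ` S \<subseteq> S" using inv[OF v] S by blast
      show "S \<subseteq> \<phi> (raag_gen \<Gamma> v) ` S"
      proof
        fix y assume y: "y \<in> S"
        then obtain x where "x \<in> V" "y = \<phi> (raag_gen \<Gamma> v) x"
          using S surj_prop[OF raag_gen_closed[OF v]] by blast
        then show "y \<in> \<phi> (raag_gen \<Gamma> v) ` S" using inv[OF v] y by blast
      qed
    qed
    then have pres: "\<phi> g ` S = S" if "g \<in> carrier (raag \<Gamma>)" for g
      using preserved S(1) that by blast
    have "(\<lambda>e. \<phi> g ` e) ` edges (induced_on T S) = edges (induced_on T S)"
      if g: "g \<in> carrier (raag \<Gamma>)" for g
    proof
      show "(\<lambda>e. \<phi> g ` e) ` edges (induced_on T S) \<subseteq> edges (induced_on T S)"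
      proof
        fix e' assume "e' \<in> (\<lambda>e. \<phi> g ` e) ` edges (induced_on T S)"
        then obtain e where e: "e' = \<phi> g ` e" "e \<in> edges T" "e \<subseteq> S" by (auto simp: induced_on_def)
        from e(2) obtain x y where xy: "e = {x, y}" "adj x y" by (rule edge_cases)
        then have "e' \<in> edges T" using adj[OF g] adjD[OF xy(2)] e(1) by simp
        moreover have "e' \<subseteq> S" using e pres[OF g] by blast
        ultimately show "e' \<in> edges (induced_on T S)" by (simp add: induced_on_def)
      qed
      show "edges (induced_on T S) \<subseteq> (\<lambda>e. \<phi> g ` e) ` edges (induced_on T S)"
      proof
        fix e assume "e \<in> edges (induced_on T S)"
        then have e: "e \<in> edges T" "e \<subseteq> S" by (auto simp: induced_on_def)
        from e(1) obtain x y where xy: "e = {x, y}" "adj x y" by (rule edge_cases)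
        then obtain x' y' where x'y': "x' \<in> S" "y' \<in> S" "x = \<phi> g x'" "y = \<phi> g y'"
          using e(2) pres[OF g] by (metis imageE insert_subset)
        then have "{x', y'} \<in> edges (induced_on T S)"
          using adj[OF g, of x' y'] S(1) xy by (auto simp: induced_on_def)
        moreover have "e = \<phi> g ` {x', y'}" using xy x'y' by simp
        ultimately show "e \<in> (\<lambda>e. \<phi> g ` e) ` edges (induced_on T S)" by blast
      qed
    qed
    then have "invariant_subtree (raag \<Gamma>) T \<phi> (induced_on T S)"
      unfolding invariant_subtree_def using induced_subtree[OF S conn] pres
      by (simp add: induced_on_def)
    then have "induced_on T S = T" using min unfolding minimal_action_def by blast
    then show "S = V" by (metis induced_on_def ugraph.select_convs(1))
  qed
qed

theorem theorem1:
  fixes \<Gamma> :: "'a ugraph"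
    and T :: "'t ugraph"
    and \<phi> :: "'a word set \<Rightarrow> 't \<Rightarrow> 't"
  assumes "simple_graph \<Gamma>"
    and "tree_action (raag \<Gamma>) T \<phi>"
    and "nontrivial_action (raag \<Gamma>) T \<phi>"
    and "minimal_action (raag \<Gamma>) T \<phi>"
    and "\<not> is_line T"
  shows "\<exists>\<Lambda>. induced_subgraph \<Lambda> \<Gamma> \<and> disconnected_graph (graph_diff \<Gamma> \<Lambda>) \<and>
           (\<exists>e \<in> edges T. raag_subgroup \<Gamma> \<Lambda> \<subseteq> edge_stabilizer (raag \<Gamma>) \<phi> e)"
proof -
  interpret commuting_family T \<Gamma> "\<lambda>v. \<phi> (raag_gen \<Gamma> v)"
    using assms(1-4) by (rule raag_commuting_family)
  have act: "group_action (raag \<Gamma>) V \<phi>" using assms(2) by (simp add: tree_action_def)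
  obtain e where e: "e \<in> edges T" "splits_at e" using splits_at_some_edge[OF assms(5)] by blast
  then obtain A B where AB: "A \<noteq> {}" "B \<noteq> {}" "A \<inter> B = {}" "A \<subseteq> verts \<Gamma>" "B \<subseteq> verts \<Gamma>"
    and no_edge: "\<And>u v. u \<in> A \<Longrightarrow> v \<in> B \<Longrightarrow> {u, v} \<notin> edges \<Gamma>"
    and stab: "\<And>w. w \<in> verts \<Gamma> - (A \<union> B) \<Longrightarrow> \<phi> (raag_gen \<Gamma> w) ` e = e"
    unfolding splits_at_def by metis
  define \<Lambda> where "\<Lambda> = induced_on \<Gamma> (verts \<Gamma> - (A \<union> B))"
  have verts_\<Lambda>: "verts \<Lambda> = verts \<Gamma> - (A \<union> B)" by (simp add: \<Lambda>_def induced_on_def)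
  have "induced_subgraph \<Lambda> \<Gamma>"
    unfolding induced_subgraph_def verts_\<Lambda> by (simp add: \<Lambda>_def)
  moreover have "disconnected_graph (graph_diff \<Gamma> \<Lambda>)"
  proof (rule disconnected_graph_if_no_edge_between)
    show "verts (graph_diff \<Gamma> \<Lambda>) = A \<union> B"
      unfolding graph_diff_def verts_\<Lambda> using AB(4,5) by (auto simp: induced_on_def)
    show "simple_graph (graph_diff \<Gamma> \<Lambda>)"
      unfolding graph_diff_def by (rule simple_graph_induced_on) (rule assms(1))
    show "{u, v} \<notin> edges (graph_diff \<Gamma> \<Lambda>)" if "u \<in> A" "v \<in> B" for u v
      using no_edge[OF that] by (simp add: graph_diff_def induced_on_def)
  qed (rule AB)+
  moreover have "raag_subgroup \<Gamma> \<Lambda> \<subseteq> edge_stabilizer (raag \<Gamma>) \<phi> e"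
  proof
    fix h assume "h \<in> raag_subgroup \<Gamma> \<Lambda>"
    then have h: "h \<in> generate (raag \<Gamma>) (raag_gen \<Gamma> ` verts \<Lambda>)" by (simp add: raag_subgroup_def)
    have gens: "raag_gen \<Gamma> ` verts \<Lambda> \<subseteq> carrier (raag \<Gamma>)"
      using raag_gen_closed[of _ \<Gamma>] by (auto simp: verts_\<Lambda>)
    have "e \<subseteq> V" using e(1) edge_finite by blast
    then have "\<phi> h ` e = e"
      using generate_preserves_set[OF act _ gens _ h] stab unfolding verts_\<Lambda> by blast
    moreover have "h \<in> carrier (raag \<Gamma>)"
      using h gens group.generate_in_carrier[OF group_presented_group] by (auto simp: raag_def)
    ultimately show "h \<in> edge_stabilizer (raag \<Gamma>) \<phi> e"
      by (simp add: edge_stabilizer_def stabilizer_def)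
  qed
  ultimately show ?thesis using e(1) by blast
qed

end
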